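(* Let $G$ be an $n$-vertex $P_6$-free graph with clique number $k$. Then $G$ contains at most $(2n)^{k+1}$ minimal separators and at most $2^{2k+2} n^{2k+3}$ potential maximal cliques.
   Context: All graphs are finite and simple. For a graph $H$, a graph $G$ is $H$-free if no induced subgraph of $G$ is isomorphic to $H$; $P_t$ denotes the path on $t$ vertices ($t-1$ edges). The clique number of $G$ is the maximum cardinality of a set of pairwise adjacent vertices of $G$. For $X \subseteq V(G)$, a connected component $C$ of $G - X$ is a full component of $X$ if $N_G(C) = X$, i.e., every vertex of $X$ has a neighbor in $C$. A set $X \subseteq V(G)$ is a minimal separator if it has at least two full components. A set $\Omega \subseteq V(G)$ is a potential maximal clique of $G$ if there is a minimal triangulation of $G$ (an inclusion-wise minimal chordal supergraph of $G$ on the same vertex set) in which $\Omega$ is a maximal clique; equivalently, no connected component of $G-\Omega$ is a full component of $\Omega$, and for every two distinct non-adjacent vertices $u,v \in \Omega$ there is a connected component $C$ of $G-\Omega$ with $u,v \in N_G(C)$. *)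

theory Defs
  imports "Graph_Theory.Graph_Theory"
begin

text \<open>
  A finite simple graph is a \<^locale>\<open>pair_graph\<close>: an edge between \<open>u\<close> and \<open>v\<close> is the pair of arcs
  \<open>(u, v)\<close> and \<open>(v, u)\<close>.
\<close>

definition path_graph :: "nat \<Rightarrow> nat pair_pre_digraph" where
  "path_graph t = \<lparr> pverts = {..<t},
     parcs = {(i, j). i < t \<and> j < t \<and> (j = Suc i \<or> i = Suc j)} \<rparr>"

text \<open>Only meant for \<open>t \<ge> 3\<close>.\<close>
definition cycle_graph :: "nat \<Rightarrow> nat pair_pre_digraph" where
  "cycle_graph t = \<lparr> pverts = {..<t},
     parcs = {(i, j). i < t \<and> j < t \<and> (j = Suc i mod t \<or> i = Suc j mod t)} \<rparr>"

definition induced_free :: "'b pair_pre_digraph \<Rightarrow> 'a pair_pre_digraph \<Rightarrow> bool" where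
  "induced_free H G \<longleftrightarrow>
     \<not> (\<exists>K. induced_subgraph K (with_proj G) \<and> digraph_iso K (with_proj H))"

definition is_clique :: "'a pair_pre_digraph \<Rightarrow> 'a set \<Rightarrow> bool" where
  "is_clique G K \<longleftrightarrow>
     K \<subseteq> pverts G \<and> (\<forall>u\<in>K. \<forall>v\<in>K. u \<noteq> v \<longrightarrow> (u, v) \<in> parcs G)"

definition maximal_clique :: "'a pair_pre_digraph \<Rightarrow> 'a set \<Rightarrow> bool" where
  "maximal_clique G K \<longleftrightarrow>
     is_clique G K \<and> (\<forall>K'. is_clique G K' \<and> K \<subseteq> K' \<longrightarrow> K' = K)"

definition clique_number :: "'a pair_pre_digraph \<Rightarrow> nat" where
  "clique_number G = Max (card ` {K. is_clique G K})"

definition nbhd :: "'a pair_pre_digraph \<Rightarrow> 'a set \<Rightarrow> 'a set" where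
  "nbhd G C = {v \<in> pverts G - C. \<exists>u\<in>C. (u, v) \<in> parcs G}"

text \<open>
  Vertex sets of the connected components of \<open>G - X\<close>; as the arcs are symmetric, these are the
  strongly connected components.
\<close>
definition components_minus :: "'a pair_pre_digraph \<Rightarrow> 'a set \<Rightarrow> 'a set set" where
  "components_minus G X = pre_digraph.sccs_verts (with_proj G \<restriction> (pverts G - X))"

definition full_component :: "'a pair_pre_digraph \<Rightarrow> 'a set \<Rightarrow> 'a set \<Rightarrow> bool" where
  "full_component G X C \<longleftrightarrow> C \<in> components_minus G X \<and> nbhd G C = X"

definition minimal_separator :: "'a pair_pre_digraph \<Rightarrow> 'a set \<Rightarrow> bool" where
  "minimal_separator G X \<longleftrightarrow>
     X \<subseteq> pverts G \<and> (\<exists>C D. C \<noteq> D \<and> full_component G X C \<and> full_component G X D)"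

definition chordal :: "'a pair_pre_digraph \<Rightarrow> bool" where
  "chordal G \<longleftrightarrow> (\<forall>t\<ge>4. induced_free (cycle_graph t) G)"

definition triangulation :: "'a pair_pre_digraph \<Rightarrow> 'a pair_pre_digraph \<Rightarrow> bool" where
  "triangulation G H \<longleftrightarrow>
     pair_graph H \<and> spanning (with_proj G) (with_proj H) \<and> chordal H"

definition minimal_triangulation :: "'a pair_pre_digraph \<Rightarrow> 'a pair_pre_digraph \<Rightarrow> bool" where
  "minimal_triangulation G H \<longleftrightarrow>
     triangulation G H \<and>
     (\<forall>H'. triangulation G H' \<and> parcs H' \<subseteq> parcs H \<longrightarrow> H' = H)"

definition potential_maximal_clique :: "'a pair_pre_digraph \<Rightarrow> 'a set \<Rightarrow> bool" where
  "potential_maximal_clique G \<Omega> \<longleftrightarrow>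
     (\<exists>H. minimal_triangulation G H \<and> maximal_clique H \<Omega>)"

end

theory Submission
  imports Defs
begin

text \<open>
  Minimal separators. Let \<open>A\<close>, \<open>B\<close> be full components of \<open>S\<close> and choose inclusion-maximal cliques in both; by
  symmetry the one in \<open>B\<close>, called \<open>K\<close>, is not larger than the one in \<open>A\<close>. If some \<open>s \<in> S\<close> has neither a
  neighbour in \<open>K\<close> nor all of \<open>A\<close> as neighbours, then an induced path on three vertices from \<open>s\<close> into \<open>A\<close>
  and one on four vertices from \<open>s\<close> into \<open>B\<close> form an induced \<open>P\<^sub>6\<close>. Hence, if \<open>T\<close> is a maximal clique among the
  vertices of \<open>S\<close> complete to \<open>A\<close>, then \<open>A\<close> is a component of the graph induced by the vertices outside
  \<open>N[K]\<close> that are complete to \<open>T\<close>. As \<open>T\<close> together with the clique chosen in \<open>A\<close> is a clique,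
  \<open>|K| + |T| \<le> k\<close>, so that \<open>S\<close> is determined by one vertex and a list of \<open>k\<close> vertices labelled \<open>K\<close> or \<open>T\<close>:
  there are at most \<open>n(2n)\<^sup>k\<close> minimal separators.

  Potential maximal cliques are counted by induction on the number of vertices, following Bouchitte and
  Todinca. After removal of a vertex \<open>a\<close>, a potential maximal clique \<open>\<Omega>\<close> leaves behind a potential maximal
  clique \<open>\<Omega> - {a}\<close>, or it has the form \<open>S \<union> {a}\<close> or \<open>S \<union> (T - {a})\<close> for minimal separators \<open>S\<close>, \<open>T\<close>.
  So each vertex contributes at most \<open>d + d\<^sup>2\<close> of them, where \<open>d\<close> bounds the number of minimal separators.
  This uses only that no component of \<open>G - \<Omega>\<close> is full and that any two non-adjacent vertices of \<open>\<Omega>\<close> have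
  neighbours in a common component of \<open>G - \<Omega>\<close>. For a maximal clique \<open>\<Omega>\<close> of a minimal triangulation \<open>H\<close> the
  former holds because in a chordal graph a connected set dominating a clique contains a vertex complete to
  it, the latter because otherwise an edge of \<open>H\<close> inside \<open>\<Omega>\<close> could be deleted.
\<close>

section \<open>Components, separators and cliques of a symmetric relation\<close>

text \<open>Only the edge relation is fixed; vertex sets are arguments. Passing to an induced
  subgraph thus means shrinking \<open>W\<close>, which suits the induction on vertices.\<close>

locale ugraph =
  fixes E :: "'a rel"
  assumes sym: "(u, v) \<in> E \<Longrightarrow> (v, u) \<in> E"
    and irrefl [simp]: "(u, u) \<notin> E"
begin

definition conn :: "'a set \<Rightarrow> bool" where
  "conn C \<longleftrightarrow> C \<noteq> {} \<and> (\<forall>x\<in>C. \<forall>y\<in>C. (x, y) \<in> rtrancl_on C E)"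

definition comp :: "'a set \<Rightarrow> 'a \<Rightarrow> 'a set" where
  "comp X x = {y. (x, y) \<in> rtrancl_on X E}"

definition comps :: "'a set \<Rightarrow> 'a set set" where
  "comps X = comp X ` X"

definition nb :: "'a set \<Rightarrow> 'a set \<Rightarrow> 'a set" where
  "nb W C = {v \<in> W - C. \<exists>u\<in>C. (u, v) \<in> E}"

definition clique :: "'a set \<Rightarrow> bool" where
  "clique K \<longleftrightarrow> (\<forall>u\<in>K. \<forall>v\<in>K. u \<noteq> v \<longrightarrow> (u, v) \<in> E)"

definition minsep :: "'a set \<Rightarrow> 'a set \<Rightarrow> bool" where
  "minsep W S \<longleftrightarrow> S \<subseteq> W \<and>
     (\<exists>C\<in>comps (W - S). \<exists>D\<in>comps (W - S). C \<noteq> D \<and> nb W C = S \<and> nb W D = S)"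

text \<open>The local characterisation of potential maximal cliques by Bouchitte and Todinca.\<close>
definition pmc :: "'a set \<Rightarrow> 'a set \<Rightarrow> bool" where
  "pmc W \<Omega> \<longleftrightarrow> \<Omega> \<subseteq> W \<and> (\<forall>C\<in>comps (W - \<Omega>). nb W C \<noteq> \<Omega>) \<and>
     (\<forall>u\<in>\<Omega>. \<forall>v\<in>\<Omega>. u \<noteq> v \<longrightarrow> (u, v) \<notin> E \<longrightarrow>
        (\<exists>C\<in>comps (W - \<Omega>). u \<in> nb W C \<and> v \<in> nb W C))"

text \<open>Distinctness of the six vertices is implied by the prescribed adjacencies and
  non-adjacencies.\<close>

definition P6_free :: "'a set \<Rightarrow> bool" where
  "P6_free W \<longleftrightarrow> \<not> (\<exists>a\<in>W. \<exists>b\<in>W. \<exists>c\<in>W. \<exists>d\<in>W. \<exists>e\<in>W. \<exists>f\<in>W.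
     (a, b) \<in> E \<and> (b, c) \<in> E \<and> (c, d) \<in> E \<and> (d, e) \<in> E \<and> (e, f) \<in> E \<and>
     (a, c) \<notin> E \<and> (a, d) \<notin> E \<and> (a, e) \<notin> E \<and> (a, f) \<notin> E \<and>
     (b, d) \<notin> E \<and> (b, e) \<notin> E \<and> (b, f) \<notin> E \<and>
     (c, e) \<notin> E \<and> (c, f) \<notin> E \<and> (d, f) \<notin> E)"

lemma P6_freeD:
  assumes "P6_free W" "a \<in> W" "b \<in> W" "c \<in> W" "d \<in> W" "e \<in> W" "f \<in> W"
    "(a, b) \<in> E" "(b, c) \<in> E" "(c, d) \<in> E" "(d, e) \<in> E" "(e, f) \<in> E"
    "(a, c) \<notin> E" "(a, d) \<notin> E" "(a, e) \<notin> E" "(a, f) \<notin> E"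
    "(b, d) \<notin> E" "(b, e) \<notin> E" "(b, f) \<notin> E" "(c, e) \<notin> E" "(c, f) \<notin> E" "(d, f) \<notin> E"
  shows False
  by (rule notE[OF assms(1)[unfolded P6_free_def]],
      rule bexI[OF _ assms(2)], rule bexI[OF _ assms(3)], rule bexI[OF _ assms(4)],
      rule bexI[OF _ assms(5)], rule bexI[OF _ assms(6)], rule bexI[OF _ assms(7)]) (use assms in simp)

section \<open>Reachability, connected sets and components\<close>

lemma comp_subset: "comp X x \<subseteq> X"
  by (auto simp: comp_def dest: in_rtrancl_on_in_F)

lemma comp_self: "x \<in> X \<Longrightarrow> x \<in> comp X x"
  by (simp add: comp_def)

lemma comp_closed: "y \<in> comp X x \<Longrightarrow> z \<in> X \<Longrightarrow> (y, z) \<in> E \<Longrightarrow> z \<in> comp X x"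
  by (auto simp: comp_def intro: rtrancl_on_into_rtrancl_on)

lemma rtrancl_on_mono_set: "(x, y) \<in> rtrancl_on X E \<Longrightarrow> X \<subseteq> Y \<Longrightarrow> (x, y) \<in> rtrancl_on Y E"
  by (induct rule: rtrancl_on_induct) (auto intro: rtrancl_on_into_rtrancl_on)

lemma rtrancl_on_sym: "(x, y) \<in> rtrancl_on X E \<Longrightarrow> (y, x) \<in> rtrancl_on X E"
  by (induct rule: rtrancl_on_induct) (auto intro: converse_rtrancl_on_into_rtrancl_on sym)

lemma conn_comp: assumes "x \<in> X" shows "conn (comp X x)"
proof -
  have *: "(x, y) \<in> rtrancl_on (comp X x) E" if "(x, y) \<in> rtrancl_on X E" for y
    using that
  proof (induct rule: rtrancl_on_induct)
    case base then show ?case using assms by (auto simp: comp_self)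
  next
    case (step y z)
    then have "z \<in> comp X x" by (auto simp: comp_def intro: rtrancl_on_into_rtrancl_on)
    then show ?case using step by (auto intro: rtrancl_on_into_rtrancl_on)
  qed
  then have "(y, z) \<in> rtrancl_on (comp X x) E" if "y \<in> comp X x" "z \<in> comp X x" for y z
    using that rtrancl_on_sym[OF *] * unfolding comp_def by (blast intro: rtrancl_on_trans)
  then show ?thesis using comp_self[OF assms] by (auto simp: conn_def)
qed

lemma conn_subset_comp:
  assumes "conn C" "C \<subseteq> X" "c \<in> C" "c \<in> comp X x" shows "C \<subseteq> comp X x"
proof
  fix y assume "y \<in> C"
  with assms have "(c, y) \<in> rtrancl_on X E" by (auto simp: conn_def intro: rtrancl_on_mono_set)
  then show "y \<in> comp X x" using assms(4) by (auto simp: comp_def intro: rtrancl_on_trans)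
qed

text \<open>A walk from \<open>x\<close> to \<open>y\<close> inside \<open>C\<close> must leave
  \<open>D\<close> somewhere. With \<open>D\<close> a neighbourhood, the crossing edge has exactly
  one end adjacent to the given vertex, which is how induced paths are grown below.\<close>

lemma conn_cut:
  assumes "conn C" "x \<in> C" "x \<in> D" "y \<in> C" "y \<notin> D"
  shows "\<exists>u\<in>C. \<exists>v\<in>C. u \<in> D \<and> v \<notin> D \<and> (u, v) \<in> E"
proof (rule ccontr)
  assume c: "\<not> ?thesis"
  have "(x, y) \<in> rtrancl_on C E" using assms by (auto simp: conn_def)
  then have "y \<in> D"
  proof (induct rule: rtrancl_on_induct)
    case base show ?case by fact
  next
    case (step y z) then show ?case using c by blast
  qed
  then show False using assms by simp
qed

lemma comp_eqI:
  assumes "conn C" "C \<subseteq> X" "c \<in> C" "\<And>u v. u \<in> C \<Longrightarrow> v \<in> X \<Longrightarrow> (u, v) \<in> E \<Longrightarrow> v \<in> C"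
  shows "comp X c = C"
proof
  show "C \<subseteq> comp X c" using assms by (intro conn_subset_comp[of C X c]) (auto simp: comp_self)
  show "comp X c \<subseteq> C"
  proof
    fix y assume y: "y \<in> comp X c"
    show "y \<in> C"
    proof (rule ccontr)
      assume "y \<notin> C"
      moreover have "conn (comp X c)" "c \<in> comp X c" using assms by (auto intro: conn_comp comp_self)
      ultimately obtain u v where "u \<in> C" "v \<in> comp X c" "v \<notin> C" "(u, v) \<in> E"
        using conn_cut[of "comp X c" c C y] assms(3) y by blast
      then show False using assms(4) comp_subset by blast
    qed
  qed
qed

text \<open>Frees components from a base point: later arguments see them as connected sets that no
  edge leaves within \<open>X\<close>.\<close>

lemma comps_iff:
  "C \<in> comps X \<longleftrightarrow> conn C \<and> C \<subseteq> X \<and> (\<forall>u\<in>C. \<forall>v\<in>X. (u, v) \<in> E \<longrightarrow> v \<in> C)"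
proof
  assume "C \<in> comps X"
  then show "conn C \<and> C \<subseteq> X \<and> (\<forall>u\<in>C. \<forall>v\<in>X. (u, v) \<in> E \<longrightarrow> v \<in> C)"
    using comp_subset unfolding comps_def by (auto intro: conn_comp comp_closed)
next
  assume *: "conn C \<and> C \<subseteq> X \<and> (\<forall>u\<in>C. \<forall>v\<in>X. (u, v) \<in> E \<longrightarrow> v \<in> C)"
  then obtain c where "c \<in> C" by (auto simp: conn_def)
  with * comp_eqI[of C X c] show "C \<in> comps X" unfolding comps_def by (metis image_eqI subsetD)
qed

lemma comp_in_comps: "x \<in> X \<Longrightarrow> comp X x \<in> comps X"
  by (simp add: comps_def)

lemma comp_eq_comps: "C \<in> comps X \<Longrightarrow> c \<in> C \<Longrightarrow> comp X c = C"
  by (intro comp_eqI) (auto simp: comps_iff)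

lemma comps_disjoint: "C \<in> comps X \<Longrightarrow> D \<in> comps X \<Longrightarrow> x \<in> C \<Longrightarrow> x \<in> D \<Longrightarrow> C = D"
  using comp_eq_comps by metis

lemma conn_subset_comps: "conn C \<Longrightarrow> C \<subseteq> X \<Longrightarrow> D \<in> comps X \<Longrightarrow> c \<in> C \<Longrightarrow> c \<in> D \<Longrightarrow> C \<subseteq> D"
  using conn_subset_comp comp_eq_comps by metis

lemma conn_insert:
  assumes "conn C" "c \<in> C" "(c, x) \<in> E" shows "conn (insert x C)"
proof -
  let ?X = "insert x C"
  have "conn (comp ?X c)" using assms by (intro conn_comp) auto
  moreover have "C \<subseteq> comp ?X c"
    using assms by (intro conn_subset_comp[of _ _ c]) (auto intro: comp_self)
  then have "comp ?X c = ?X" using comp_subset[of ?X c] comp_closed[of c ?X c x] assms by auto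
  ultimately show ?thesis by simp
qed

lemma nb_comps_subset: "C \<in> comps (W - X) \<Longrightarrow> nb W C \<subseteq> X"
  by (auto simp: nb_def comps_iff)

lemma clique_insert: "clique K \<Longrightarrow> (\<And>u. u \<in> K \<Longrightarrow> u \<noteq> x \<Longrightarrow> (x, u) \<in> E) \<Longrightarrow> clique (insert x K)"
  by (auto simp: clique_def intro: sym)

text \<open>Irreflexivity keeps members of \<open>K\<close> from satisfying the premises of
  maximality, so \<open>x \<notin> K\<close> is implicit. If \<open>R\<close> is non-empty,
  maximality also forces \<open>K\<close> to be non-empty.\<close>

lemma ex_maximal_clique:
  assumes "finite R"
  obtains K where "K \<subseteq> R" "clique K" "\<And>x. x \<in> R \<Longrightarrow> (\<And>u. u \<in> K \<Longrightarrow> (x, u) \<in> E) \<Longrightarrow> False"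
proof -
  have "finite {K. K \<subseteq> R \<and> clique K}" using assms by auto
  moreover have "{} \<in> {K. K \<subseteq> R \<and> clique K}" by (simp add: clique_def)
  ultimately have "\<exists>K\<in>{K. K \<subseteq> R \<and> clique K}. \<forall>L\<in>{K. K \<subseteq> R \<and> clique K}. K \<subseteq> L \<longrightarrow> K = L"
    by (intro finite_has_maximal) auto
  then obtain K where KF: "K \<in> {K. K \<subseteq> R \<and> clique K}"
    and max: "\<forall>L\<in>{K. K \<subseteq> R \<and> clique K}. K \<subseteq> L \<longrightarrow> K = L"
    by (rule bexE)
  from KF have K: "K \<subseteq> R" "clique K" by auto
  have False if x: "x \<in> R" "\<And>u. u \<in> K \<Longrightarrow> (x, u) \<in> E" for x
  proof -
    have "clique (insert x K)" using x K by (intro clique_insert) auto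
    then have "K = insert x K" using x K by (intro max[rule_format]) auto
    then show False using x irrefl[of x] by blast
  qed
  with K show thesis by (rule that)
qed

section \<open>Minimal separators of \<open>P\<^sub>6\<close>-free graphs\<close>

text \<open>If \<open>s\<close> misses \<open>K\<close>, then \<open>K\<close> lies in one component
  \<open>D\<close> of the non-neighbours of \<open>s\<close> in \<open>B\<close>. Some
  \<open>z\<close> in \<open>B\<close> outside \<open>D\<close> has a neighbour in \<open>D\<close>,
  and \<open>z\<close> is adjacent to \<open>s\<close>, as otherwise it would belong to
  \<open>D\<close>. By maximality \<open>z\<close> misses a vertex of \<open>K\<close>, so
  \<open>D\<close> has an edge \<open>pq\<close> with \<open>z\<close> adjacent to \<open>p\<close>
  only. With an edge \<open>xy\<close> of \<open>A\<close> leaving the neighbourhood of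
  \<open>s\<close>, the path \<open>y, x, s, z, p, q\<close> is an induced
  \<open>P\<^sub>6\<close>.\<close>

lemma domination:
  assumes P6: "P6_free W" and W: "A \<subseteq> W" "B \<subseteq> W" "s \<in> W"
    and A: "conn A" "a \<in> A" "(s, a) \<in> E" "a' \<in> A" "(s, a') \<notin> E"
    and B: "conn B" "b \<in> B" "(s, b) \<in> E"
    and AB: "\<And>x y. x \<in> A \<Longrightarrow> y \<in> B \<Longrightarrow> (x, y) \<notin> E"
    and K: "K \<subseteq> B" "clique K"
    and max: "\<And>x. x \<in> B \<Longrightarrow> (\<And>u. u \<in> K \<Longrightarrow> (x, u) \<in> E) \<Longrightarrow> False"
  shows "\<exists>u\<in>K. (s, u) \<in> E"
proof (rule ccontr)
  assume nK: "\<not> (\<exists>u\<in>K. (s, u) \<in> E)"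
  obtain y x where yx: "x \<in> A" "(s, x) \<in> E" "y \<in> A" "(s, y) \<notin> E" "(x, y) \<in> E"
    using conn_cut[of A a "{x. (s, x) \<in> E}" a'] A by auto
  define X where "X = {z \<in> B. (s, z) \<notin> E}"
  obtain c where c: "c \<in> K" using max[of b] B by blast
  then have cX: "c \<in> X" using nK K by (auto simp: X_def)
  define D where "D = comp X c"
  have KX: "K \<subseteq> X" using nK K by (auto simp: X_def)
  have KD: "K \<subseteq> D"
  proof
    fix y assume y: "y \<in> K"
    show "y \<in> D"
    proof (cases "y = c")
      case False
      then have "(c, y) \<in> E" using K(2) c y by (auto simp: clique_def)
      then show ?thesis using comp_closed[OF comp_self[OF cX]] KX y by (auto simp: D_def)
    qed (use comp_self[OF cX] in \<open>simp add: D_def\<close>)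
  qed
  have "b \<notin> D" "c \<in> D" using B comp_subset[of X c] cX by (auto simp: D_def X_def comp_self)
  then obtain d z where z: "d \<in> D" "z \<in> B" "z \<notin> D" "(d, z) \<in> E"
    using conn_cut[OF B(1), of c D b] B(2) c K(1) by (auto simp: subset_iff)
  have sz: "(s, z) \<in> E" using z comp_closed[of d X c z] by (auto simp: D_def X_def)
  obtain c' where c': "c' \<in> K" "(z, c') \<notin> E" using max[of z] z by blast
  have "conn D" using cX by (simp add: D_def conn_comp)
  then obtain p q where pq: "p \<in> D" "(z, p) \<in> E" "q \<in> D" "(z, q) \<notin> E" "(p, q) \<in> E"
    using conn_cut[OF \<open>conn D\<close>, of d "{p. (z, p) \<in> E}" c'] z(1) sym[OF z(4)] c' KD by auto
  have "p \<in> X" "q \<in> X" using pq comp_subset by (auto simp: D_def)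
  then have "p \<in> B" "q \<in> B" "(s, p) \<notin> E" "(s, q) \<notin> E" by (auto simp: X_def)
  moreover have "(y, x) \<in> E" "(x, s) \<in> E" "(y, s) \<notin> E" using yx sym by blast+
  moreover have "(y, z) \<notin> E" "(y, p) \<notin> E" "(y, q) \<notin> E" "(x, z) \<notin> E" "(x, p) \<notin> E" "(x, q) \<notin> E"
    using AB yx z(2) \<open>p \<in> B\<close> \<open>q \<in> B\<close> by blast+
  ultimately show False
    using P6_freeD[OF P6, of y x s z p q] sz pq yx(1,3) z(2) W by (simp add: subset_iff)
qed

lemma minsep_code:
  assumes fin: "finite W" and P6: "P6_free W"
    and k: "\<And>K. K \<subseteq> W \<Longrightarrow> clique K \<Longrightarrow> card K \<le> k"
    and S: "minsep W S"
  obtains a K T where "a \<in> W" "K \<subseteq> W" "T \<subseteq> W" "K \<noteq> {}" "card K + card T \<le> k"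
    "S = nb W (comp {x \<in> W - K. (\<forall>b\<in>K. (b, x) \<notin> E) \<and> (\<forall>t\<in>T. (t, x) \<in> E)} a)"
proof -
  note code = that
  \<comment> \<open>The roles are ordered by clique size. The code stores the smaller clique
    \<open>KB\<close>, while the bound comes from the clique \<open>KA \<union> T\<close>, whose
    size is at least that of \<open>KB\<close> plus that of \<open>T\<close>.\<close>
  have main: thesis
    if A: "A \<in> comps (W - S)" "nb W A = S" and B: "B \<in> comps (W - S)" "nb W B = S" and ne: "A \<noteq> B"
      and KA: "KA \<subseteq> A" "clique KA"
      and KB: "KB \<subseteq> B" "clique KB" "\<And>x. x \<in> B \<Longrightarrow> (\<And>u. u \<in> KB \<Longrightarrow> (x, u) \<in> E) \<Longrightarrow> False"
      and le: "card KB \<le> card KA" for A B KA KB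
  proof -
    define R where "R = {t \<in> S. \<forall>a\<in>A. (a, t) \<in> E}"
    have SW: "S \<subseteq> W" using S by (simp add: minsep_def)
    have sub: "A \<subseteq> W" "B \<subseteq> W" "A \<inter> S = {}" "B \<inter> S = {}" using A B by (auto simp: comps_iff)
    have disj: "A \<inter> B = {}" using comps_disjoint[OF A(1) B(1)] ne by auto
    have AB: "(x, y) \<notin> E" if "x \<in> A" "y \<in> B" for x y
      using A B that disj unfolding comps_iff by blast
    have "finite R" using fin SW finite_subset[of R W] by (auto simp: R_def)
    then obtain T where T: "T \<subseteq> R" "clique T"
      "\<And>x. x \<in> R \<Longrightarrow> (\<And>u. u \<in> T \<Longrightarrow> (x, u) \<in> E) \<Longrightarrow> False"
      using ex_maximal_clique by blast
    obtain a where a: "a \<in> A" using A by (auto simp: comps_iff conn_def)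
    define X where "X = {x \<in> W - KB. (\<forall>b\<in>KB. (b, x) \<notin> E) \<and> (\<forall>t\<in>T. (t, x) \<in> E)}"
    have AX: "A \<subseteq> X"
      using sub KB disj AB T(1) sym by (fastforce simp: X_def R_def)
    \<comment> \<open>A vertex \<open>v\<close> of \<open>X\<close> outside \<open>A\<close> with a
      neighbour in \<open>A\<close> lies in \<open>S\<close>. It misses \<open>KB\<close>, so
      \<open>domination\<close> makes it complete to \<open>A\<close>; being adjacent to all of
      \<open>T\<close>, it contradicts the maximality of \<open>T\<close>.\<close>
    have "comp X a = A"
    proof (rule comp_eqI)
      show "conn A" using A by (simp add: comps_iff)
      show "A \<subseteq> X" "a \<in> A" by fact+
      fix u v assume uv: "u \<in> A" "v \<in> X" "(u, v) \<in> E"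
      show "v \<in> A"
      proof (rule ccontr)
        assume "v \<notin> A"
        then have "v \<in> nb W A" using uv by (auto simp: nb_def X_def)
        then have vS: "v \<in> S" using A by simp
        then obtain b where b: "b \<in> B" "(b, v) \<in> E" using B by (auto simp: nb_def)
        have nd: "\<not> (\<exists>u\<in>KB. (v, u) \<in> E)" using uv(2) sym by (auto simp: X_def)
        have "v \<in> R"
        proof (rule ccontr)
          assume "v \<notin> R"
          then obtain a' where "a' \<in> A" "(v, a') \<notin> E" using vS sym by (auto simp: R_def)
          moreover have "v \<in> W" "conn A" "conn B" using vS SW A(1) B(1) by (auto simp: comps_iff)
          ultimately have "\<exists>u\<in>KB. (v, u) \<in> E"
            using domination[OF P6 sub(1,2), where s = v and a = u and a' = a' and b = b and K = KB]
              uv(1) uv(3) b AB KB sym by blast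
          with nd show False by blast
        qed
        then show False using T(3)[of v] uv(2) sym by (auto simp: X_def)
      qed
    qed
    then have S_eq: "S = nb W (comp X a)" using A by simp
    have "clique (KA \<union> T)" using KA T sym unfolding clique_def R_def by blast
    moreover have "KA \<union> T \<subseteq> W" using KA T sub SW by (auto simp: R_def)
    ultimately have "card (KA \<union> T) \<le> k" by (intro k)
    moreover have "card (KA \<union> T) = card KA + card T"
    proof (rule card_Un_disjoint)
      show "finite KA" "finite T"
        using \<open>KA \<union> T \<subseteq> W\<close> fin finite_subset by blast+
      show "KA \<inter> T = {}" using KA T sub by (auto simp: R_def)
    qed
    ultimately have "card KB + card T \<le> k" using le by simp
    moreover have "KB \<noteq> {}" using KB(3) B(1) by (auto simp: comps_iff conn_def)
    ultimately show thesis
      using S_eq[unfolded X_def] a sub(1,2) KB(1) T(1) SW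
      by (intro code[of a KB T]) (auto simp: R_def)
  qed
  obtain A B where AB: "A \<in> comps (W - S)" "B \<in> comps (W - S)" "A \<noteq> B" "nb W A = S" "nb W B = S"
    using S by (auto simp: minsep_def)
  have "finite A" "finite B" using AB fin by (auto simp: comps_iff intro: finite_subset)
  obtain KA where KA: "KA \<subseteq> A" "clique KA" "\<And>x. x \<in> A \<Longrightarrow> (\<And>u. u \<in> KA \<Longrightarrow> (x, u) \<in> E) \<Longrightarrow> False"
    using ex_maximal_clique[OF \<open>finite A\<close>] by blast
  obtain KB where KB: "KB \<subseteq> B" "clique KB" "\<And>x. x \<in> B \<Longrightarrow> (\<And>u. u \<in> KB \<Longrightarrow> (x, u) \<in> E) \<Longrightarrow> False"
    using ex_maximal_clique[OF \<open>finite B\<close>] by blast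
  show thesis
    using main[of A B KA KB] main[of B A KB KA] AB KA KB nat_le_linear[of "card KA" "card KB"] by blast
qed

lemma card_minsep:
  assumes fin: "finite W" and P6: "P6_free W"
    and k: "\<And>K. K \<subseteq> W \<Longrightarrow> clique K \<Longrightarrow> card K \<le> k"
  shows "card {S. minsep W S} \<le> card W * (2 * card W) ^ k"
proof -
  \<comment> \<open>The decoder reads entries tagged \<open>True\<close> as members of
    \<open>K\<close> and those tagged \<open>False\<close> as members of \<open>T\<close>.\<close>
  define dec where "dec = (\<lambda>(a, xs :: (bool \<times> 'a) list).
    nb W (comp {x \<in> W - {b. (True, b) \<in> set xs}.
      (\<forall>b\<in>{b. (True, b) \<in> set xs}. (b, x) \<notin> E) \<and> (\<forall>t\<in>{t. (False, t) \<in> set xs}. (t, x) \<in> E)} a))"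
  let ?L = "{xs. set xs \<subseteq> (UNIV :: bool set) \<times> W \<and> length xs = k}"
  have "{S. minsep W S} \<subseteq> dec ` (W \<times> ?L)"
  proof
    fix S assume "S \<in> {S. minsep W S}"
    then obtain a K T where *: "a \<in> W" "K \<subseteq> W" "T \<subseteq> W" "K \<noteq> {}" "card K + card T \<le> k"
      "S = nb W (comp {x \<in> W - K. (\<forall>b\<in>K. (b, x) \<notin> E) \<and> (\<forall>t\<in>T. (t, x) \<in> E)} a)"
      using minsep_code[OF fin P6 k] by blast
    have "finite K" "finite T" using * fin finite_subset by auto
    then obtain ks ts where ks: "set ks = K" "length ks = card K" and ts: "set ts = T" "length ts = card T"
      by (metis finite_distinct_list distinct_card)
    obtain b where b: "b \<in> K" using * by blast
    \<comment> \<open>Repeating some \<open>b\<close> of the non-empty \<open>K\<close> pads the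
      list to length exactly \<open>k\<close> without changing the encoded sets.\<close>
    define xs where "xs = map (Pair True) ks @ map (Pair False) ts
      @ replicate (k - card K - card T) (True, b)"
    have "{b. (True, b) \<in> set xs} = K" "{t. (False, t) \<in> set xs} = T" 
      using b ks ts by (auto simp: xs_def)
    then have "dec (a, xs) = S" by (simp only: dec_def prod.case *(6))
    moreover have "xs \<in> ?L" using * ks ts b by (auto simp: xs_def)
    ultimately show "S \<in> dec ` (W \<times> ?L)" using \<open>a \<in> W\<close> by blast
  qed
  moreover have finL: "finite ?L" using fin by (intro finite_lists_length_eq) (simp add: finite_cartesian_product)
  ultimately have "card {S. minsep W S} \<le> card (dec ` (W \<times> ?L))"
    using fin by (intro card_mono) auto
  also have "\<dots> \<le> card (W \<times> ?L)" using fin finL by (intro card_image_le) auto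
  also have "\<dots> = card W * (2 * card W) ^ k"
    using fin by (simp add: card_cartesian_product card_lists_length_eq)
  finally show ?thesis .
qed

section \<open>Removing a vertex from a potential maximal clique\<close>

text \<open>Edges leave \<open>C\<close> only into \<open>nb W C\<close>, so putting the rest of
  \<open>X\<close> back attaches nothing to \<open>C\<close>.\<close>

lemma nb_comps_closed: "C \<in> comps (W - X) \<Longrightarrow> C \<in> comps (W - nb W C)"
  by (fastforce simp: comps_iff nb_def)

text \<open>Let \<open>Q\<close> be the component of \<open>v\<close> and \<open>T\<close> its
  neighbourhood, which lies inside that of \<open>U\<close>. Then \<open>Q\<close> is full for
  \<open>T\<close>, and so is the component containing \<open>U\<close>, since every vertex of
  \<open>T\<close> has a neighbour in \<open>U\<close>. They differ because \<open>U\<close> is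
  itself a component once \<open>nb W U\<close> is removed.\<close>

lemma minsep_nb_comp:
  assumes U: "conn U" "U \<subseteq> W" and v: "v \<in> W" "v \<notin> U" "v \<notin> nb W U"
  shows "minsep W (nb W (comp (W - nb W U) v))"
proof -
  define N where "N = nb W U"
  define Q where "Q = comp (W - N) v"
  define T where "T = nb W Q"
  have Q: "Q \<in> comps (W - N)" "v \<in> Q"
    using v by (auto simp: Q_def N_def intro: comp_in_comps comp_self)
  have TN: "T \<subseteq> N" unfolding T_def using Q(1) by (rule nb_comps_subset)
  have QT: "Q \<in> comps (W - T)" unfolding T_def using Q(1) by (rule nb_comps_closed)
  obtain u where u: "u \<in> U" using U by (auto simp: conn_def)
  have UT: "U \<subseteq> W - T" using TN U by (auto simp: N_def nb_def)
  define D where "D = comp (W - T) u"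
  have D: "D \<in> comps (W - T)" "u \<in> D"
    using u UT by (auto simp: D_def intro: comp_in_comps comp_self)
  have UD: "U \<subseteq> D" using conn_subset_comps[OF U(1) UT D(1) u D(2)] .
  have "nb W D \<subseteq> T" using D(1) by (rule nb_comps_subset)
  moreover have "T \<subseteq> nb W D"
  proof
    fix t assume t: "t \<in> T"
    then have "t \<in> nb W U" using TN by (auto simp: N_def)
    moreover have "t \<notin> D" using D(1) t by (auto simp: comps_iff)
    ultimately show "t \<in> nb W D" using UD by (auto simp: nb_def)
  qed
  moreover have "Q \<noteq> D"
  proof
    assume "Q = D"
    have "U \<in> comps (W - N)" using U by (auto simp: comps_iff N_def nb_def)
    then have "Q = U" using comps_disjoint[OF Q(1) _ _ u] D(2) \<open>Q = D\<close> by blast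
    then show False using v Q by simp
  qed
  moreover have "T \<subseteq> W" "nb W Q = T" by (auto simp: T_def nb_def)
  ultimately have "minsep W T"
    using D(1) QT unfolding minsep_def by blast
  then show ?thesis by (simp add: T_def Q_def N_def)
qed

lemma pmc_cover:
  assumes "pmc W \<Omega>" "x \<in> \<Omega>" "y \<in> \<Omega>" "x \<noteq> y"
  obtains "(x, y) \<in> E" | F where "F \<in> comps (W - \<Omega>)" "x \<in> nb W F" "y \<in> nb W F"
  using assms unfolding pmc_def by blast

text \<open>Either \<open>xy\<close> is an edge, or a component of \<open>W - \<Omega>\<close> sees
  both ends. That component stays inside \<open>X\<close> and, joined to \<open>x\<close>, is
  swallowed by \<open>D\<close>.\<close>

lemma pmc_connects:
  assumes P: "pmc W \<Omega>" and xy: "x \<in> \<Omega>" "y \<in> \<Omega>" "x \<noteq> y"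
    and D: "D \<in> comps X" "x \<in> D" "X \<subseteq> W" "y \<notin> X" "W - \<Omega> \<subseteq> X"
  shows "y \<in> nb W D"
proof -
  have "y \<in> W" using P xy by (auto simp: pmc_def)
  moreover have "y \<notin> D" using D by (auto simp: comps_iff)
  moreover have "\<exists>u\<in>D. (u, y) \<in> E"
    using P xy
  proof (cases rule: pmc_cover)
    case 1 then show ?thesis using D by blast
  next
    case (2 F)
    obtain f where f: "f \<in> F" "(f, x) \<in> E" using 2 by (auto simp: nb_def)
    have "conn (insert x F)" using 2(1) f by (auto simp: comps_iff intro: conn_insert)
    moreover have "insert x F \<subseteq> X" using 2(1) D by (auto simp: comps_iff)
    ultimately have "insert x F \<subseteq> D" using conn_subset_comps[OF _ _ D(1) _ D(2)] by blast
    then show ?thesis using 2(3) by (auto simp: nb_def)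
  qed
  ultimately show ?thesis by (auto simp: nb_def)
qed

text \<open>Supplies the second full component when, in the two removal lemmas below,
  \<open>S\<close> is already the neighbourhood of a component of
  \<open>W - \<Omega>\<close>.\<close>

lemma pmc_full_comp:
  assumes P: "pmc W \<Omega>" and S: "S \<subseteq> \<Omega>" "x \<in> \<Omega>" "x \<notin> S"
  shows "nb W (comp (W - S) x) = S"
proof
  have "x \<in> W" using P S by (auto simp: pmc_def)
  then have D: "comp (W - S) x \<in> comps (W - S)" "x \<in> comp (W - S) x"
    using S by (auto intro: comp_in_comps comp_self)
  then show "nb W (comp (W - S) x) \<subseteq> S" by (intro nb_comps_subset)
  show "S \<subseteq> nb W (comp (W - S) x)"
  proof
    fix y assume "y \<in> S"
    then show "y \<in> nb W (comp (W - S) x)"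
      using S by (intro pmc_connects[OF P _ _ _ D]) auto
  qed
qed

text \<open>The components outside are unchanged and still cover all non-adjacent pairs, so only
  non-fullness can fail: some \<open>C\<close> sees all of \<open>\<Omega> - {a}\<close>. As
  \<open>C\<close> is not full for \<open>\<Omega>\<close>, it misses \<open>a\<close>; then
  \<open>C\<close> and the component of \<open>a\<close> are two full components of
  \<open>\<Omega> - {a}\<close>.\<close>

lemma pmc_remove_in:
  assumes P: "pmc W \<Omega>" and a: "a \<in> \<Omega>" and n: "\<not> pmc (W - {a}) (\<Omega> - {a})"
  shows "minsep W (\<Omega> - {a})"
proof -
  have eq: "W - {a} - (\<Omega> - {a}) = W - \<Omega>" using a by auto
  have nb: "nb (W - {a}) C = nb W C - {a}" for C by (auto simp: nb_def)
  have \<Omega>: "\<Omega> \<subseteq> W" using P by (simp add: pmc_def)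
  have "\<exists>C\<in>comps (W - \<Omega>). nb W C - {a} = \<Omega> - {a}"
  proof (rule ccontr)
    assume no: "\<not> ?thesis"
    have "pmc (W - {a}) (\<Omega> - {a})"
      unfolding pmc_def eq nb
    proof (intro conjI ballI impI)
      show "\<Omega> - {a} \<subseteq> W - {a}" using \<Omega> by auto
      show "nb W C - {a} \<noteq> \<Omega> - {a}" if "C \<in> comps (W - \<Omega>)" for C using no that by blast
      fix u v assume "u \<in> \<Omega> - {a}" "v \<in> \<Omega> - {a}" "u \<noteq> v" "(u, v) \<notin> E"
      then show "\<exists>C\<in>comps (W - \<Omega>). u \<in> nb W C - {a} \<and> v \<in> nb W C - {a}"
        using P unfolding pmc_def by blast
    qed
    with n show False by simp
  qed
  then obtain C where C: "C \<in> comps (W - \<Omega>)" "nb W C - {a} = \<Omega> - {a}" by blast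
  have "nb W C \<noteq> \<Omega>" using C P by (simp add: pmc_def)
  then have nbC: "nb W C = \<Omega> - {a}" using C a nb_comps_subset[OF C(1)] by blast
  have "C \<in> comps (W - (\<Omega> - {a}))" using nb_comps_closed[OF C(1)] nbC by simp
  moreover have "comp (W - (\<Omega> - {a})) a \<in> comps (W - (\<Omega> - {a}))"
    using a \<Omega> by (auto intro: comp_in_comps)
  moreover have "nb W (comp (W - (\<Omega> - {a})) a) = \<Omega> - {a}"
    using a by (intro pmc_full_comp[OF P]) auto
  moreover have "C \<noteq> comp (W - (\<Omega> - {a})) a"
    using C(1) a \<Omega> comp_self[of a "W - (\<Omega> - {a})"] by (auto simp: comps_iff)
  ultimately show ?thesis using nbC \<Omega> unfolding minsep_def by blast
qed

text \<open>Deleting \<open>a\<close> only breaks up a component, so no full one can appear and some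
  pair \<open>u, v\<close> must lose its cover. The component \<open>C\<close> that covered it
  contains \<open>a\<close>. Take \<open>S\<close> as the neighbourhood of \<open>C\<close>, and let
  \<open>T\<close> account for the vertices of \<open>\<Omega> - S\<close>.\<close>

lemma pmc_remove_notin:
  assumes P: "pmc W \<Omega>" and a: "a \<in> W" "a \<notin> \<Omega>" and n: "\<not> pmc (W - {a}) \<Omega>"
  shows "\<exists>S T. minsep W S \<and> minsep W T \<and> \<Omega> = S \<union> (T - {a})"
proof -
  have \<Omega>: "\<Omega> \<subseteq> W" using P by (simp add: pmc_def)
  have nbW: "w \<in> nb (W - {a}) F \<longleftrightarrow> w \<in> nb W F" if "w \<in> \<Omega>" for w F
    using a that by (auto simp: nb_def)
  have nfull: "nb (W - {a}) F \<noteq> \<Omega>" if F: "F \<in> comps (W - {a} - \<Omega>)" for F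
  proof
    assume full: "nb (W - {a}) F = \<Omega>"
    obtain f where f: "f \<in> F" using F by (auto simp: comps_iff conn_def)
    have sub: "F \<subseteq> W - \<Omega>" using F by (auto simp: comps_iff)
    define C where "C = comp (W - \<Omega>) f"
    have C: "C \<in> comps (W - \<Omega>)" "f \<in> C"
      using f sub by (auto simp: C_def intro: comp_in_comps comp_self)
    have "F \<subseteq> C" using conn_subset_comps[OF _ sub C(1) f C(2)] F by (simp add: comps_iff)
    moreover have "C \<inter> \<Omega> = {}" using C by (auto simp: comps_iff)
    ultimately have "\<Omega> \<subseteq> nb W C" using full \<Omega> by (fastforce simp: nb_def)
    then show False using P C nb_comps_subset[OF C(1)] by (auto simp: pmc_def)
  qed
  have "\<exists>u\<in>\<Omega>. \<exists>v\<in>\<Omega>. u \<noteq> v \<and> (u, v) \<notin> E \<and>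
    (\<forall>F\<in>comps (W - {a} - \<Omega>). \<not> (u \<in> nb (W - {a}) F \<and> v \<in> nb (W - {a}) F))"
    using n nfull \<Omega> a unfolding pmc_def by blast
  then obtain u v where uv: "u \<in> \<Omega>" "v \<in> \<Omega>" "u \<noteq> v" "(u, v) \<notin> E"
    and unc': "\<forall>F\<in>comps (W - {a} - \<Omega>). \<not> (u \<in> nb (W - {a}) F \<and> v \<in> nb (W - {a}) F)"
    by (elim bexE conjE)
  have unc: False if "F \<in> comps (W - {a} - \<Omega>)" "u \<in> nb W F" "v \<in> nb W F" for F
    using unc' that nbW uv by simp
  obtain C where C: "C \<in> comps (W - \<Omega>)" "u \<in> nb W C" "v \<in> nb W C"
    using pmc_cover[OF P uv(1-3)] uv(4) by metis
  have "a \<in> C"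
  proof (rule ccontr)
    assume "a \<notin> C"
    then have "C \<in> comps (W - {a} - \<Omega>)" using C(1) by (auto simp: comps_iff)
    then show False using unc C by blast
  qed
  define S where "S = nb W C"
  have S\<Omega>: "S \<subseteq> \<Omega>" unfolding S_def using C(1) by (rule nb_comps_subset)
  moreover have "S \<noteq> \<Omega>" using P C by (auto simp: S_def pmc_def)
  ultimately obtain x where x: "x \<in> \<Omega>" "x \<notin> S" by blast
  have "minsep W S"
  proof -
    have "C \<in> comps (W - S)" unfolding S_def using C(1) by (rule nb_comps_closed)
    moreover have "comp (W - S) x \<in> comps (W - S)" using x \<Omega> by (auto intro: comp_in_comps)
    moreover have "nb W (comp (W - S) x) = S" using pmc_full_comp[OF P S\<Omega> x] .
    moreover have "C \<noteq> comp (W - S) x"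
      using C(1) x \<Omega> comp_self[of x "W - S"] by (auto simp: comps_iff)
    ultimately show ?thesis using S\<Omega> \<Omega> unfolding minsep_def S_def by blast
  qed
  \<comment> \<open>The component of \<open>a\<close> is the only one seen by both \<open>u\<close> and \<open>v\<close>, and none is left without \<open>a\<close>, so
    \<open>Y\<close> separates \<open>u\<close> from \<open>v\<close>; a minimal separator inside \<open>Y\<close> gives \<open>T\<close>.\<close>
  define Y where "Y = insert a \<Omega> - {u, v}"
  have WY: "u \<in> W - Y" "v \<in> W - Y" using uv \<Omega> a by (auto simp: Y_def)
  define U where "U = comp (W - Y) u"
  define V where "V = comp (W - Y) v"
  have U: "U \<in> comps (W - Y)" "u \<in> U" and V: "V \<in> comps (W - Y)" "v \<in> V"
    using WY by (auto simp: U_def V_def intro: comp_in_comps comp_self)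
  have "v \<notin> U"
  proof
    assume "v \<in> U"
    \<comment> \<open>\<open>Z\<close> collects \<open>u\<close> and the components without
      \<open>a\<close> that see \<open>u\<close>. An edge leaving \<open>Z\<close> inside
      \<open>U\<close> can only end in \<open>v\<close>, and then one of these components would see
      \<open>v\<close> as well.\<close>
    define Z where "Z = insert u (\<Union>{F \<in> comps (W - {a} - \<Omega>). u \<in> nb W F})"
    have "v \<notin> Z" using uv by (auto simp: Z_def comps_iff)
    then obtain p q where pq: "p \<in> U" "q \<in> U" "p \<in> Z" "q \<notin> Z" "(p, q) \<in> E"
      using conn_cut[of U u Z v] U \<open>v \<in> U\<close> by (auto simp: comps_iff Z_def)
    have q: "q = v \<or> q \<in> W - {a} - \<Omega>" using pq U by (auto simp: comps_iff Y_def Z_def)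
    show False
    proof (cases "p = u")
      case True
      then have q: "q \<in> W - {a} - \<Omega>" using q pq uv by auto
      define F where "F = comp (W - {a} - \<Omega>) q"
      have F: "F \<in> comps (W - {a} - \<Omega>)" "q \<in> F"
        using q by (auto simp: F_def intro: comp_in_comps comp_self)
      have "u \<notin> F" using F uv by (auto simp: comps_iff)
      then have "u \<in> nb W F" using F True pq sym uv \<Omega> by (auto simp: nb_def)
      then show False using F pq(4) by (auto simp: Z_def)
    next
      case False
      then obtain F where F: "F \<in> comps (W - {a} - \<Omega>)" "u \<in> nb W F" "p \<in> F"
        using pq by (auto simp: Z_def)
      show False
      proof (cases "q = v")
        case True
        then have "v \<in> nb W F" using F pq uv \<Omega> by (auto simp: nb_def comps_iff)
        then show False using unc F by blast
      next
        case False
        then have "q \<in> F" using q F pq by (auto simp: comps_iff)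
        then show False using F pq by (auto simp: Z_def)
      qed
    qed
  qed
  define N where "N = nb W U"
  have NY: "N \<subseteq> Y" unfolding N_def using U(1) by (rule nb_comps_subset)
  define Q where "Q = comp (W - N) v"
  define T where "T = nb W Q"
  have vN: "v \<in> W - N" using WY NY by auto
  have "minsep W T"
    unfolding T_def Q_def N_def
    using U vN \<open>v \<notin> U\<close> by (intro minsep_nb_comp) (auto simp: comps_iff N_def)
  have Q: "Q \<in> comps (W - N)" "v \<in> Q"
    using vN by (auto simp: Q_def intro: comp_in_comps comp_self)
  have TN: "T \<subseteq> N" unfolding T_def using Q(1) by (rule nb_comps_subset)
  have "V \<subseteq> W - N" using V NY by (auto simp: comps_iff)
  then have VQ: "V \<subseteq> Q" using conn_subset_comps[OF _ _ Q(1) V(2) Q(2)] V by (simp add: comps_iff)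
  \<comment> \<open>Since \<open>y\<close> is not in \<open>S\<close>, a component covering
    \<open>y\<close> and \<open>w\<close> is not \<open>C\<close>. So it avoids \<open>a\<close> and
    survives the removal of \<open>Y\<close>.\<close>
  have near: "y \<in> nb W D" if y: "y \<in> \<Omega>" "y \<notin> S" and D: "D \<in> comps (W - Y)" "w \<in> D" and w: "w \<in> {u, v}"
    for y D w
  proof -
    have yY: "y \<in> Y" using y C(2,3) by (auto simp: Y_def S_def)
    have yw: "y \<noteq> w" "w \<in> \<Omega>" using w yY uv by (auto simp: Y_def)
    have "y \<notin> D" using yY D by (auto simp: comps_iff)
    moreover have "\<exists>z\<in>D. (z, y) \<in> E"
      using P yw(2) y(1) yw(1)[symmetric]
    proof (cases rule: pmc_cover)
      case 1 then show ?thesis using D by blast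
    next
      case (2 F)
      have "F \<noteq> C" using 2 y by (auto simp: S_def)
      then have "a \<notin> F" using comps_disjoint[OF 2(1) C(1)] \<open>a \<in> C\<close> by blast
      obtain f where f: "f \<in> F" "(f, w) \<in> E" using 2 by (auto simp: nb_def)
      have "conn (insert w F)" using 2(1) f by (auto simp: comps_iff intro: conn_insert)
      moreover have "insert w F \<subseteq> W - Y"
        using 2(1) D \<open>a \<notin> F\<close> by (auto simp: comps_iff Y_def)
      ultimately have "insert w F \<subseteq> D" using conn_subset_comps[OF _ _ D(1) _ D(2)] by blast
      then show ?thesis using 2(3) by (auto simp: nb_def)
    qed
    ultimately show ?thesis using y \<Omega> by (auto simp: nb_def)
  qed
  have "\<Omega> - S \<subseteq> T"
  proof
    fix y assume y: "y \<in> \<Omega> - S"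
    have "y \<in> N" unfolding N_def using near[of y U u] y U by auto
    then have "y \<notin> Q" using Q by (auto simp: comps_iff)
    moreover have "y \<in> nb W V" using near[of y V v] y V by auto
    ultimately show "y \<in> T" using VQ by (auto simp: T_def nb_def)
  qed
  moreover have "T - {a} \<subseteq> \<Omega>" using TN NY by (auto simp: Y_def)
  ultimately have "\<Omega> = S \<union> (T - {a})" using S\<Omega> a by auto
  then show ?thesis using \<open>minsep W S\<close> \<open>minsep W T\<close> by blast
qed

text \<open>Otherwise the component of \<open>a\<close> in \<open>W - \<Omega>\<close> would be full
  for \<open>\<Omega>\<close>. This makes removal of \<open>a\<close> injective in the count that
  follows.\<close>

lemma pmc_not_insert:
  assumes P: "pmc W \<Omega>" "a \<notin> \<Omega>" shows "\<not> pmc W (insert a \<Omega>)"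
proof
  assume P': "pmc W (insert a \<Omega>)"
  then have a: "a \<in> W - \<Omega>" using P by (auto simp: pmc_def)
  have D: "comp (W - \<Omega>) a \<in> comps (W - \<Omega>)" using a by (rule comp_in_comps)
  have "nb W (comp (W - \<Omega>) a) = \<Omega>" using P by (intro pmc_full_comp[OF P']) auto
  then show False using D P by (auto simp: pmc_def)
qed

lemma card_pmc_remove:
  assumes fin: "finite W" and a: "a \<in> W" and d: "card {S. minsep W S} \<le> d"
  shows "card {\<Omega>. pmc W \<Omega>} \<le> card {\<Omega>. pmc (W - {a}) \<Omega>} + (d + d * d)"
proof -
  let ?M = "{S. minsep W S}"
  let ?X = "{\<Omega>. pmc W \<Omega> \<and> pmc (W - {a}) (\<Omega> - {a})}"
  let ?Y = "insert a ` ?M" and ?Z = "(\<lambda>(S, T). S \<union> (T - {a})) ` (?M \<times> ?M)"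
  have finM: "finite ?M" by (rule finite_subset[of _ "Pow W"]) (use fin in \<open>auto simp: minsep_def\<close>)
  have finX: "finite {\<Omega>. pmc V \<Omega> \<and> R \<Omega>}" if "finite V" for V R
    by (rule finite_subset[of _ "Pow V"]) (use that in \<open>auto simp: pmc_def\<close>)
  have "{\<Omega>. pmc W \<Omega>} \<subseteq> ?X \<union> (?Y \<union> ?Z)"
  proof
    fix \<Omega> assume "\<Omega> \<in> {\<Omega>. pmc W \<Omega>}"
    then have P: "pmc W \<Omega>" by simp
    show "\<Omega> \<in> ?X \<union> (?Y \<union> ?Z)"
    proof (cases "pmc (W - {a}) (\<Omega> - {a})")
      case True then show ?thesis using P by simp
    next
      case n: False
      show ?thesis
      proof (cases "a \<in> \<Omega>")
        case True
        then have "minsep W (\<Omega> - {a})" "\<Omega> = insert a (\<Omega> - {a})" using pmc_remove_in[OF P] n by auto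
        then show ?thesis by blast
      next
        case False
        then obtain S T where "minsep W S" "minsep W T" "\<Omega> = S \<union> (T - {a})"
          using pmc_remove_notin[OF P a] n by auto
        then have "\<Omega> \<in> ?Z" by (intro image_eqI[of _ _ "(S, T)"]) auto
        then show ?thesis by blast
      qed
    qed
  qed
  then have "card {\<Omega>. pmc W \<Omega>} \<le> card (?X \<union> (?Y \<union> ?Z))"
    using finM finX[OF fin] by (intro card_mono) auto
  also have "\<dots> \<le> card ?X + (card ?Y + card ?Z)"
    by (intro order_trans[OF card_Un_le] add_mono order_refl card_Un_le)
  also have "card ?X \<le> card {\<Omega>. pmc (W - {a}) \<Omega>}"
  proof (rule card_inj_on_le)
    \<comment> \<open>Two sets with the same image differ at most in \<open>a\<close>, which
      \<open>pmc_not_insert\<close> excludes.\<close>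
    show "inj_on (\<lambda>\<Omega>. \<Omega> - {a}) ?X"
    proof (rule inj_onI)
      fix O1 O2 assume O: "O1 \<in> ?X" "O2 \<in> ?X" "O1 - {a} = O2 - {a}"
      then have "O1 = O2 \<or> (a \<notin> O1 \<and> O2 = insert a O1) \<or> (a \<notin> O2 \<and> O1 = insert a O2)" by blast
      then show "O1 = O2" using pmc_not_insert O by auto
    qed
    show "(\<lambda>\<Omega>. \<Omega> - {a}) ` ?X \<subseteq> {\<Omega>. pmc (W - {a}) \<Omega>}" by auto
    show "finite {\<Omega>. pmc (W - {a}) \<Omega>}" using finX[of "W - {a}" "\<lambda>_. True"] fin by simp
  qed
  also have "card ?Y \<le> d" using d card_image_le[OF finM, of "insert a"] by linarith
  also have "card ?Z \<le> card (?M \<times> ?M)" using finM by (intro card_image_le) auto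
  also have "\<dots> \<le> d * d" using d by (simp add: card_cartesian_product mult_le_mono)
  finally show ?thesis by simp
qed

text \<open>The induction descends through induced subgraphs, hence the bound \<open>d\<close> for
  every \<open>V \<subseteq> W\<close>. The summand 1 pays for the empty set in the empty
  graph.\<close>

lemma card_pmc:
  assumes "finite W" and "\<And>V. V \<subseteq> W \<Longrightarrow> card {S. minsep V S} \<le> d"
  shows "card {\<Omega>. pmc W \<Omega>} \<le> card W * (d + d * d) + 1"
  using assms
proof (induct rule: finite_induct)
  case empty
  have "{\<Omega>. pmc {} \<Omega>} \<subseteq> {{}}" by (auto simp: pmc_def)
  then have "card {\<Omega>. pmc {} \<Omega>} \<le> card {{} :: 'a set}" by (intro card_mono) auto
  then show ?case by simp
next
  case (insert a W)
  then have "card {\<Omega>. pmc W \<Omega>} \<le> card W * (d + d * d) + 1" by (meson subset_insertI2)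
  moreover have "card {\<Omega>. pmc (insert a W) \<Omega>} \<le> card {\<Omega>. pmc W \<Omega>} + (d + d * d)"
    using card_pmc_remove[of "insert a W" a d] insert by simp
  ultimately show ?case using insert by simp
qed

section \<open>Chordal graphs and minimal triangulations\<close>

text \<open>An induced cycle through \<open>f 0, ..., f (t - 1)\<close>. By symmetry only pairs
  \<open>i < j\<close> are listed; the disjunct \<open>i = 0 \<and> Suc j = t\<close> is the closing
  edge.\<close>

definition hole :: "'a set \<Rightarrow> (nat \<Rightarrow> 'a) \<Rightarrow> nat \<Rightarrow> bool" where
  "hole W f t \<longleftrightarrow> 4 \<le> t \<and> f ` {..<t} \<subseteq> W \<and>
     (\<forall>i j. i < j \<longrightarrow> j < t \<longrightarrow> f i \<noteq> f j \<and> ((f i, f j) \<in> E \<longleftrightarrow> j = Suc i \<or> i = 0 \<and> Suc j = t))"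

lemma hole_rev:
  assumes "hole W f t" shows "hole W (\<lambda>i. f (t - Suc i)) t"
proof -
  have "f (t - Suc i) \<noteq> f (t - Suc j) \<and>
      ((f (t - Suc i), f (t - Suc j)) \<in> E \<longleftrightarrow> j = Suc i \<or> i = 0 \<and> Suc j = t)"
    if "i < j" "j < t" for i j
  proof -
    have "t - Suc j < t - Suc i" "t - Suc i < t" using that by auto
    then have "f (t - Suc j) \<noteq> f (t - Suc i) \<and> ((f (t - Suc j), f (t - Suc i)) \<in> E \<longleftrightarrow>
        t - Suc i = Suc (t - Suc j) \<or> t - Suc j = 0 \<and> Suc (t - Suc i) = t)"
      using assms unfolding hole_def by blast
    moreover have "t - Suc i = Suc (t - Suc j) \<longleftrightarrow> j = Suc i" using that by auto
    moreover have "t - Suc j = 0 \<and> Suc (t - Suc i) = t \<longleftrightarrow> i = 0 \<and> Suc j = t" using that by auto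
    ultimately show ?thesis using sym by metis
  qed
  then show ?thesis using assms by (auto simp: hole_def)
qed

text \<open>The cycle passes through \<open>S\<close> on both arcs between \<open>f i\<close> and
  \<open>f j\<close>. These two vertices are not consecutive on the cycle, hence non-adjacent,
  although \<open>S\<close> is a clique. Reversal by \<open>hole_rev\<close> reduces to
  \<open>i < j\<close>.\<close>

lemma hole_clique_separator:
  assumes h: "hole W f t"
    and CS: "\<And>x y. x \<in> C \<Longrightarrow> (x, y) \<in> E \<Longrightarrow> y \<in> C \<union> S" and S: "clique S" "C \<inter> S = {}"
    and ij: "i < t" "j < t" "f i \<in> C" "f j \<notin> C \<union> S"
  shows False
proof -
  have main: False if h: "hole W f t" and ij: "i < j" "j < t" "f i \<in> C" "f j \<notin> C \<union> S" for f i j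
  proof -
    have step: "(f l, f (Suc l)) \<in> E" if "Suc l < t" for l using h that by (auto simp: hole_def)
    have nonadj: False if "p < q" "q < t" "q \<noteq> Suc p" "p \<noteq> 0 \<or> Suc q \<noteq> t" "f p \<in> S" "f q \<in> S" for p q
      using h that S(1) unfolding hole_def clique_def by metis
    \<comment> \<open>The first exit from \<open>C\<close> after \<open>i\<close>: it lies in
      \<open>S\<close> and comes before \<open>j\<close>.\<close>
    define p where "p = (LEAST p. i < p \<and> f p \<notin> C)"
    have p: "i < p" "f p \<notin> C" "p \<le> j"
      using LeastI[of "\<lambda>p. i < p \<and> f p \<notin> C" j] Least_le[of "\<lambda>p. i < p \<and> f p \<notin> C" j] ij
      by (auto simp: p_def)
    have "f (p - 1) \<in> C"
      using not_less_Least[of "p - 1" "\<lambda>p. i < p \<and> f p \<notin> C"] p ij(3) unfolding p_def[symmetric]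
      by (cases "p - 1 = i") auto
    then have pS: "f p \<in> S" using CS[of "f (p - 1)" "f p"] step[of "p - 1"] p ij by auto
    then have "p < j" using ij p by (cases "p = j") auto
    show False
    \<comment> \<open>The second passage through \<open>S\<close> is the first return after
      \<open>j\<close>. If there is none before index \<open>t\<close>, the return happens across
      the closing edge, and the last vertex before \<open>i\<close> outside \<open>C\<close> serves
      instead.\<close>
    proof (cases "\<exists>q. j < q \<and> q < t \<and> f q \<in> C \<union> S")
      case True
      then obtain q0 where q0: "j < q0 \<and> q0 < t \<and> f q0 \<in> C \<union> S" ..
      define q where "q = (LEAST q. j < q \<and> q < t \<and> f q \<in> C \<union> S)"
      have q: "j < q" "q < t" "f q \<in> C \<union> S"
        using LeastI[of "\<lambda>q. j < q \<and> q < t \<and> f q \<in> C \<union> S", OF q0] by (auto simp: q_def)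
      have "f (q - 1) \<notin> C \<union> S"
        using not_less_Least[of "q - 1" "\<lambda>q. j < q \<and> q < t \<and> f q \<in> C \<union> S"] q ij(4)
        unfolding q_def[symmetric] by (cases "q - 1 = j") auto
      then have "f q \<in> S" using CS[of "f q" "f (q - 1)"] step[of "q - 1"] q sym by auto
      then show False using nonadj[of p q] pS \<open>p < j\<close> q p by auto
    next
      case False
      then have "f (t - 1) \<notin> C \<union> S" using ij by (cases "t - 1 = j") auto
      moreover have "(f 0, f (t - 1)) \<in> E" using h by (auto simp: hole_def)
      ultimately have f0: "f 0 \<notin> C" using CS by blast
      then have i0: "i \<noteq> 0" using ij by (cases "i = 0") auto
      define q where "q = (GREATEST q. q < i \<and> f q \<notin> C)"
      have q: "q < i" "f q \<notin> C"
        using GreatestI_nat[of "\<lambda>q. q < i \<and> f q \<notin> C" 0 i] f0 i0 by (auto simp: q_def)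
      have "f (Suc q) \<in> C"
      proof (rule ccontr)
        assume "f (Suc q) \<notin> C"
        then have "Suc q < i" using q ij by (cases "Suc q = i") auto
        then show False
          using Greatest_le_nat[of "\<lambda>q. q < i \<and> f q \<notin> C" "Suc q" i] \<open>f (Suc q) \<notin> C\<close>
          by (auto simp: q_def)
      qed
      then have "f q \<in> S" using CS[of "f (Suc q)" "f q"] step[of q] q ij sym by auto
      then show False using nonadj[of q p] pS \<open>p < j\<close> q p ij by auto
    qed
  qed
  show False
  proof (cases i j rule: linorder_cases)
    case less then show False using main[OF h less] ij by blast
  next
    case greater
    then have "t - Suc i < t - Suc j" "t - Suc j < t"
      "t - Suc (t - Suc i) = i" "t - Suc (t - Suc j) = j" using ij by auto
    then show False using main[OF hole_rev[OF h], of "t - Suc i" "t - Suc j"] ij by simp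
  qed (use ij in auto)
qed

section \<open>Induced paths and vertices complete to a clique\<close>

lemma rtrancl_on_walk:
  assumes "(x, y) \<in> rtrancl_on C E"
  shows "\<exists>m p. p 0 = x \<and> p m = y \<and> (\<forall>i\<le>m. p i \<in> C) \<and> (\<forall>i<m. (p i, p (Suc i)) \<in> E)"
  using assms
proof (induct rule: rtrancl_on_induct)
  case base then show ?case by (intro exI[of _ 0] exI[of _ "\<lambda>_. x"]) simp
next
  case (step y z)
  then obtain m p where "p 0 = x" "p m = y" "\<forall>i\<le>m. p i \<in> C" "\<forall>i<m. (p i, p (Suc i)) \<in> E" by blast
  then show ?case using step
    by (intro exI[of _ "Suc m"] exI[of _ "p(Suc m := z)"]) (auto simp: less_Suc_eq le_Suc_eq)
qed

text \<open>A shortest walk in \<open>C\<close> from \<open>P\<close> to \<open>N\<close> works: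
  another visit to \<open>P\<close> or \<open>N\<close>, a chord or a repeated vertex would each
  allow a shorter one.\<close>

lemma ex_induced_path:
  assumes C: "conn C" and P: "x \<in> C" "x \<in> P" and N: "y \<in> C" "y \<in> N"
  obtains p m where "\<And>i. i \<le> m \<Longrightarrow> p i \<in> C" "p 0 \<in> P" "p m \<in> N"
    "\<And>i. i \<le> m \<Longrightarrow> p i \<in> P \<Longrightarrow> i = 0" "\<And>i. i \<le> m \<Longrightarrow> p i \<in> N \<Longrightarrow> i = m"
    "\<And>i j. i < j \<Longrightarrow> j \<le> m \<Longrightarrow> p i \<noteq> p j"
    "\<And>i j. i < j \<Longrightarrow> j \<le> m \<Longrightarrow> (p i, p j) \<in> E \<longleftrightarrow> j = Suc i"
proof -
  define walk where "walk = (\<lambda>p m. p 0 \<in> P \<and> p m \<in> N \<and> (\<forall>i\<le>m. p i \<in> C) \<and> (\<forall>i<m. (p i, p (Suc i)) \<in> E))"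
  have "\<exists>m p. walk p m"
    using rtrancl_on_walk[of x y C] C P N by (auto simp: conn_def walk_def)
  then obtain m where "\<exists>p. walk p m" and min: "\<And>l. l < m \<Longrightarrow> \<not> (\<exists>p. walk p l)"
    using exists_least_iff[of "\<lambda>m. \<exists>p. walk p m"] by auto
  then obtain p where p: "walk p m" by blast
  then have pC: "p i \<in> C" if "i \<le> m" for i using that by (simp add: walk_def)
  have pE: "(p i, p (Suc i)) \<in> E" if "i < m" for i using that p by (simp add: walk_def)
  have pP: "i = 0" if "i \<le> m" "p i \<in> P" for i
  proof -
    have "walk (\<lambda>l. p (l + i)) (m - i)" using p that by (simp add: walk_def)
    then have "\<not> m - i < m" using min by blast
    then show ?thesis using that by simp
  qed
  have pN: "i = m" if "i \<le> m" "p i \<in> N" for i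
  proof -
    have "walk p i" using p that by (simp add: walk_def)
    then have "\<not> i < m" using min by blast
    then show ?thesis using that by simp
  qed
  have chord: "j = Suc i" if ij: "i < j" "j \<le> m" "(p i, p j) \<in> E" for i j
  proof (rule ccontr)
    assume "j \<noteq> Suc i"
    then have ij': "Suc i < j" using ij by simp
    \<comment> \<open>The walk that takes the chord from \<open>p i\<close> to \<open>p j\<close>,
      skipping the \<open>j - Suc i\<close> vertices in between.\<close>
    define q where "q = (\<lambda>l. if l \<le> i then p l else p (l + (j - Suc i)))"
    have "(q l, q (Suc l)) \<in> E" if "l < m - (j - Suc i)" for l
    proof (cases l i rule: linorder_cases)
      case equal then show ?thesis using ij by (simp add: q_def)
    qed (use that ij pE in \<open>auto simp: q_def\<close>)
    moreover have "q l \<in> C" if "l \<le> m - (j - Suc i)" for l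
      using that ij pC by (auto simp: q_def)
    moreover have "q 0 \<in> P" using p by (simp add: q_def walk_def)
    moreover have "q (m - (j - Suc i)) = p m" using ij ij' by (auto simp: q_def)
    ultimately have "walk q (m - (j - Suc i))" using p by (simp add: walk_def)
    then show False using min[of "m - (j - Suc i)"] ij ij' by auto
  qed
  \<comment> \<open>A repetition yields a chord from \<open>i\<close> to \<open>Suc j\<close> or, if
    \<open>j = m\<close>, a visit to \<open>N\<close> before the end.\<close>
  have "p i \<noteq> p j" if ij: "i < j" "j \<le> m" for i j
  proof
    assume eq: "p i = p j"
    show False
    proof (cases "j = m")
      case True
      then have "p i \<in> N" using p eq by (simp add: walk_def)
      then show False using pN[of i] ij True by simp
    next
      case False
      then have "(p i, p (Suc j)) \<in> E" using pE[of j] eq ij by simp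
      then show False using chord[of i "Suc j"] ij False by simp
    qed
  qed
  moreover have "(p i, p j) \<in> E \<longleftrightarrow> j = Suc i" if "i < j" "j \<le> m" for i j
    using that chord pE by auto
  ultimately show thesis using that[of m p] pC pP pN p by (simp add: walk_def)
qed

text \<open>Induction on the clique: join a vertex complete to \<open>K\<close> to a neighbour of
  \<open>v\<close> by a shortest path. If its end \<open>p m\<close> misses some \<open>w\<close> in
  \<open>K\<close>, the part after the last neighbour \<open>p l\<close> of \<open>w\<close> closes
  up with \<open>v\<close> and \<open>w\<close> to a hole; it has length at least 4 since
  \<open>l < m\<close>.\<close>

lemma chordal_complete_vertex:
  assumes chordal: "\<And>f t. \<not> hole W f t" and C: "conn C" "C \<subseteq> W"
    and K: "finite K" "K \<subseteq> W" "clique K" "K \<inter> C = {}" "\<And>v. v \<in> K \<Longrightarrow> \<exists>c\<in>C. (c, v) \<in> E"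
  shows "\<exists>c\<in>C. \<forall>v\<in>K. (c, v) \<in> E"
  using K
proof (induct rule: finite_induct)
  case empty then show ?case using C by (auto simp: conn_def)
next
  case (insert v K)
  then obtain x where x: "x \<in> C" "\<forall>w\<in>K. (x, w) \<in> E"
    by (auto simp: clique_def)
  obtain y where y: "y \<in> C" "(y, v) \<in> E" using insert by blast
  define P where "P = {c. \<forall>w\<in>K. (c, w) \<in> E}"
  define N where "N = {c. (c, v) \<in> E}"
  have xP: "x \<in> P" and yN: "y \<in> N" using x y by (auto simp: P_def N_def)
  obtain p m where p: "\<And>i. i \<le> m \<Longrightarrow> p i \<in> C" "p 0 \<in> P" "p m \<in> N"
    "\<And>i. i \<le> m \<Longrightarrow> p i \<in> P \<Longrightarrow> i = 0" "\<And>i. i \<le> m \<Longrightarrow> p i \<in> N \<Longrightarrow> i = m"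
    "\<And>i j. i < j \<Longrightarrow> j \<le> m \<Longrightarrow> p i \<noteq> p j"
    "\<And>i j. i < j \<Longrightarrow> j \<le> m \<Longrightarrow> (p i, p j) \<in> E \<longleftrightarrow> j = Suc i"
    by (rule ex_induced_path[OF C(1) x(1) xP y(1) yN]) (rule that)
  show ?case
  proof (cases "m = 0")
    case True
    then show ?thesis using p(1)[of 0] p(2,3) by (auto simp: P_def N_def)
  next
    case False
    then have "p m \<notin> P" using p(4)[of m] by auto
    then obtain w where w: "w \<in> K" "(p m, w) \<notin> E" by (auto simp: P_def)
    define l where "l = (GREATEST i. i \<le> m \<and> (p i, w) \<in> E)"
    have "0 \<le> m \<and> (p 0, w) \<in> E" using p(2) w by (auto simp: P_def)
    then have l: "l \<le> m" "(p l, w) \<in> E"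
      using GreatestI_nat[of "\<lambda>i. i \<le> m \<and> (p i, w) \<in> E" 0 m] by (auto simp: l_def)
    then have "l < m" using w by (cases "l = m") auto
    have lw: "(p i, w) \<notin> E" if "l < i" "i \<le> m" for i
      using Greatest_le_nat[of "\<lambda>i. i \<le> m \<and> (p i, w) \<in> E" i m] that by (auto simp: l_def)
    have vw: "(v, w) \<in> E" "v \<noteq> w" "v \<notin> C" "w \<notin> C" "v \<in> W" "w \<in> W"
      using insert w by (auto simp: clique_def)
    \<comment> \<open>\<open>p l, \<dots>, p m, v, w\<close> is a hole.\<close>
    define L where "L = m - l"
    have L: "0 < L" "l + L = m" using \<open>l < m\<close> by (auto simp: L_def)
    define f where "f = (\<lambda>i. if i \<le> L then p (l + i) else if i = Suc L then v else w)"
    have "hole W f (L + 3)"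
      unfolding hole_def
    proof (intro conjI allI impI)
      show "4 \<le> L + 3" using L by simp
      show "f ` {..<L + 3} \<subseteq> W" using p(1) C(2) vw L by (auto simp: f_def)
      fix i j :: nat assume ij: "i < j" "j < L + 3"
      consider "j \<le> L" | "j = Suc L" | "j = Suc (Suc L)" using ij by linarith
      then have "f i \<noteq> f j \<and> ((f i, f j) \<in> E \<longleftrightarrow> j = Suc i \<or> i = 0 \<and> Suc j = L + 3)"
      proof cases
        case 1
        then show ?thesis using p(6,7)[of "l + i" "l + j"] ij L by (auto simp: f_def)
      next
        case 2
        then have "(p (l + i), v) \<in> E \<longleftrightarrow> i = L"
          using p(5)[of "l + i"] p(3) ij L by (auto simp: N_def)
        moreover have "p (l + i) \<noteq> v" using p(1)[of "l + i"] vw 2 ij L by auto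
        ultimately show ?thesis using 2 ij L by (auto simp: f_def)
      next
        case 3
        show ?thesis
        proof (cases "i \<le> L")
          case True
          then have "(p (l + i), w) \<in> E \<longleftrightarrow> i = 0" using lw[of "l + i"] l L by (cases "i = 0") auto
          moreover have "p (l + i) \<noteq> w" using p(1)[of "l + i"] vw True L by auto
          ultimately show ?thesis using 3 True L by (auto simp: f_def)
        next
          case False
          then show ?thesis using 3 ij vw by (auto simp: f_def)
        qed
      qed
      then show "f i \<noteq> f j" "(f i, f j) \<in> E \<longleftrightarrow> j = Suc i \<or> i = 0 \<and> Suc j = L + 3" by blast+
    qed
    then show ?thesis using chordal by blast
  qed
qed

end

text \<open>Maximality of \<open>\<Omega>\<close> in \<open>F\<close> rules out full components;
  minimality of \<open>F\<close> provides the covering components.\<close>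

lemma pmc_of_minimal_triangulation:
  assumes "ugraph E" "ugraph F" and fin: "finite V"
    and E: "E \<subseteq> F" "F \<subseteq> V \<times> V" and chordal: "\<And>f t. \<not> ugraph.hole F V f t"
    and min: "\<And>F'. ugraph F' \<Longrightarrow> E \<subseteq> F' \<Longrightarrow> F' \<subseteq> F \<Longrightarrow> (\<And>f t. \<not> ugraph.hole F' V f t) \<Longrightarrow> F' = F"
    and \<Omega>: "\<Omega> \<subseteq> V" "ugraph.clique F \<Omega>"
    and max: "\<And>x. x \<in> V \<Longrightarrow> x \<notin> \<Omega> \<Longrightarrow> ugraph.clique F (insert x \<Omega>) \<Longrightarrow> False"
  shows "ugraph.pmc E V \<Omega>"
proof -
  interpret E: ugraph E by fact
  interpret F: ugraph F by fact
  have nfull: "E.nb V C \<noteq> \<Omega>" if C: "C \<in> E.comps (V - \<Omega>)" for C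
  proof
    assume full: "E.nb V C = \<Omega>"
    have "(x, y) \<in> rtrancl_on C F" if "(x, y) \<in> rtrancl_on C E" for x y
      using that E(1) by (induct rule: rtrancl_on_induct) (auto intro: rtrancl_on_into_rtrancl_on)
    then have "F.conn C" using C by (auto simp: E.comps_iff E.conn_def F.conn_def)
    moreover have "\<exists>c\<in>C. (c, v) \<in> F" if "v \<in> \<Omega>" for v
      using that E(1) unfolding full[symmetric] E.nb_def by blast
    moreover have "C \<subseteq> V" "\<Omega> \<inter> C = {}" using C by (auto simp: E.comps_iff)
    moreover have "finite \<Omega>" using \<Omega>(1) fin by (rule finite_subset)
    ultimately obtain c where c: "c \<in> C" "\<forall>v\<in>\<Omega>. (c, v) \<in> F"
      using F.chordal_complete_vertex[OF chordal, of C \<Omega>] \<Omega> by blast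
    then have "F.clique (insert c \<Omega>)" using \<Omega>(2) by (intro F.clique_insert) auto
    then show False using max[of c] c(1) C by (auto simp: E.comps_iff)
  qed
  have "\<exists>C\<in>E.comps (V - \<Omega>). u \<in> E.nb V C \<and> v \<in> E.nb V C"
    if uv: "u \<in> \<Omega>" "v \<in> \<Omega>" "u \<noteq> v" "(u, v) \<notin> E" for u v
  proof (rule ccontr)
    assume unc: "\<not> ?thesis"
    \<comment> \<open>Deleting \<open>uv\<close> and all edges between different components keeps \<open>F\<close> chordal, because the
      neighbourhoods of the components remain cliques.\<close>
    define F' where "F' = {(x, y) \<in> F. (\<exists>C\<in>E.comps (V - \<Omega>). x \<in> C \<union> E.nb V C \<and> y \<in> C \<union> E.nb V C)
      \<or> x \<in> \<Omega> \<and> y \<in> \<Omega> \<and> {x, y} \<noteq> {u, v}}"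
    have nbO: "E.nb V C \<subseteq> \<Omega>" "C \<inter> \<Omega> = {}" if "C \<in> E.comps (V - \<Omega>)" for C
      using that E.nb_comps_subset[OF that] by (auto simp: E.comps_iff)
    interpret F': ugraph F'
    proof
      show "(y, x) \<in> F'" if "(x, y) \<in> F'" for x y
        using that F.sym by (auto simp: F'_def)
    qed (auto simp: F'_def)
    have F'_in: "(x, y) \<in> F' \<longleftrightarrow> (x, y) \<in> F"
      if "C \<in> E.comps (V - \<Omega>)" "x \<in> C \<union> E.nb V C" "y \<in> C \<union> E.nb V C" for x y C
      using that by (auto simp: F'_def)
    have F'_out: "y \<in> C \<union> E.nb V C"
      if C: "C \<in> E.comps (V - \<Omega>)" and x: "x \<in> C" "(x, y) \<in> F'" for x y C
    proof -
      have "x \<notin> \<Omega>" using C x nbO by blast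
      then obtain D where D: "D \<in> E.comps (V - \<Omega>)" "x \<in> D \<union> E.nb V D" "y \<in> D \<union> E.nb V D"
        using x by (auto simp: F'_def)
      then have "x \<in> D" using \<open>x \<notin> \<Omega>\<close> nbO by blast
      then have "D = C" using E.comps_disjoint[OF D(1) C _ x(1)] by blast
      then show ?thesis using D by blast
    qed
    have "E \<subseteq> F'"
    proof (rule subrelI)
      fix x y assume xy: "(x, y) \<in> E"
      then have V: "x \<in> V" "y \<in> V" using E by auto
      have out: "(x, y) \<in> F'" if xy: "(x, y) \<in> E" and x: "x \<in> V - \<Omega>" and y: "y \<in> V" for x y
      proof -
        define C where "C = E.comp (V - \<Omega>) x"
        have C: "C \<in> E.comps (V - \<Omega>)" "x \<in> C"
          using x by (auto simp: C_def intro: E.comp_in_comps E.comp_self)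
        have "y \<in> C \<union> E.nb V C" using C(2) xy y by (auto simp: E.nb_def)
        then show ?thesis using F'_in[OF C(1)] C(2) xy E(1) by blast
      qed
      show "(x, y) \<in> F'"
      proof (cases "x \<in> \<Omega> \<and> y \<in> \<Omega>")
        case True
        moreover have "{x, y} \<noteq> {u, v}" using xy uv(4) E.sym by (auto simp: doubleton_eq_iff)
        ultimately show ?thesis using xy E(1) by (auto simp: F'_def)
      next
        case False
        then show ?thesis using out[of x y] out[of y x] xy V E.sym F'.sym by blast
      qed
    qed
    moreover have "\<not> F'.hole V f t" for f t
    proof
      assume h: "F'.hole V f t"
      then have t: "4 \<le> t" and fV: "\<And>i. i < t \<Longrightarrow> f i \<in> V" by (auto simp: F'.hole_def)
      show False
      \<comment> \<open>A hole meeting a component \<open>C\<close> either leaves \<open>C\<close>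
        and its neighbourhood, impossible as that neighbourhood is a clique separator, or stays
        there, where \<open>F'\<close> agrees with the chordal \<open>F\<close>.\<close>
      proof (cases "\<exists>i<t. f i \<notin> \<Omega>")
        case True
        then obtain i where i: "i < t" "f i \<notin> \<Omega>" by blast
        define C where "C = E.comp (V - \<Omega>) (f i)"
        have C: "C \<in> E.comps (V - \<Omega>)" "f i \<in> C"
          using i fV by (auto simp: C_def intro: E.comp_in_comps E.comp_self)
        have cl: "F'.clique (E.nb V C)"
          unfolding F'.clique_def using F'_in[OF C(1)] \<Omega>(2) nbO[OF C(1)] unfolding F.clique_def by blast
        show False
        proof (cases "\<exists>j<t. f j \<notin> C \<union> E.nb V C")
          case True
          then obtain j where j: "j < t" "f j \<notin> C \<union> E.nb V C" by blast
          show False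
          proof (rule F'.hole_clique_separator[OF h _ cl _ i(1) j(1) C(2) j(2)])
            show "C \<inter> E.nb V C = {}" by (auto simp: E.nb_def)
          qed (rule F'_out[OF C(1)])
        next
          case False
          then have "(f i, f j) \<in> F' \<longleftrightarrow> (f i, f j) \<in> F" if "i < t" "j < t" for i j
            using that F'_in[OF C(1)] by blast
          then have "F.hole V f t" using h unfolding F.hole_def F'.hole_def
            by (metis order_less_trans)
          then show False using chordal by blast
        qed
      next
        case False
        \<comment> \<open>Within \<open>\<Omega>\<close> only the pair \<open>uv\<close> can be
          non-adjacent in \<open>F'\<close>, but a hole has the two different non-adjacent pairs
          \<open>f 0, f 2\<close> and \<open>f 1, f 3\<close>.\<close>
        have "{f i, f (i + 2)} = {u, v}" if "i < 2" for i
        proof -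
          have "f i \<noteq> f (i + 2)" "(f i, f (i + 2)) \<notin> F'"
            using h t that unfolding F'.hole_def by auto
          moreover have "(f i, f (i + 2)) \<in> F"
            using False \<open>f i \<noteq> f (i + 2)\<close> \<Omega>(2) t that unfolding F.clique_def by auto
          ultimately show ?thesis using False t that by (auto simp: F'_def)
        qed
        from this[of 0] this[of 1] have "f 1 \<in> {f 0, f 2}" by (auto simp: numeral_2_eq_2)
        moreover have ne: "\<And>i j. i < j \<Longrightarrow> j < t \<Longrightarrow> f i \<noteq> f j" using h by (simp add: F'.hole_def)
        have "f 0 \<noteq> f 1" "f 1 \<noteq> f 2" using t ne[of 0 1] ne[of 1 2] by simp_all
        ultimately show False by auto
      qed
    qed
    moreover have "F' \<subseteq> F" by (auto simp: F'_def)
    ultimately have "F' = F" by (intro min F'.ugraph_axioms)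
    moreover have "(u, v) \<in> F" using uv \<Omega>(2) by (auto simp: F.clique_def)
    moreover have "(u, v) \<notin> F'"
    proof
      assume "(u, v) \<in> F'"
      then obtain C where "C \<in> E.comps (V - \<Omega>)" "u \<in> C \<union> E.nb V C" "v \<in> C \<union> E.nb V C"
        by (auto simp: F'_def)
      then show False using unc nbO(2) uv(1,2) by blast
    qed
    ultimately show False by simp
  qed
  then show ?thesis using nfull \<Omega>(1) unfolding E.pmc_def by blast
qed

section \<open>Translation to pair graphs\<close>

text \<open>An isomorphism from \<open>K\<close> onto \<open>Q\<close> yields the embedding
  \<open>f\<close> as the inverse of its vertex map. Conversely, \<open>f\<close> identifies
  \<open>Q\<close> with the subgraph induced on its image.\<close>

lemma induced_free_iff:
  assumes G: "pair_wf_digraph G" and Q: "parcs Q \<subseteq> pverts Q \<times> pverts Q"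
  shows "induced_free Q G \<longleftrightarrow> \<not> (\<exists>f. inj_on f (pverts Q) \<and> f ` pverts Q \<subseteq> pverts G \<and>
    (\<forall>i\<in>pverts Q. \<forall>j\<in>pverts Q. (f i, f j) \<in> parcs G \<longleftrightarrow> (i, j) \<in> parcs Q))"
proof -
  interpret pair_wf_digraph G by fact
  have "(\<exists>K. induced_subgraph K (with_proj G) \<and> digraph_iso K (with_proj Q)) \<longleftrightarrow>
    (\<exists>f. inj_on f (pverts Q) \<and> f ` pverts Q \<subseteq> pverts G \<and>
    (\<forall>i\<in>pverts Q. \<forall>j\<in>pverts Q. (f i, f j) \<in> parcs G \<longleftrightarrow> (i, j) \<in> parcs Q))" (is "?L \<longleftrightarrow> ?R")
  proof
    assume ?L
    then obtain K h where K: "induced_subgraph K (with_proj G)"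
      and h: "pre_digraph.digraph_isomorphism K h" and eq: "with_proj Q = app_iso h K"
      unfolding digraph_iso_def by blast
    have tl: "tail K = fst" "head K = snd" and VK: "verts K \<subseteq> pverts G"
      and AK: "arcs K = {e \<in> parcs G. fst e \<in> verts K \<and> snd e \<in> verts K}"
      using K unfolding induced_subgraph_def subgraph_def compatible_def by auto
    have inj: "inj_on (iso_verts h) (verts K)"
      and ends: "\<And>e. e \<in> arcs K \<Longrightarrow> iso_verts h (fst e) = iso_tail h (iso_arcs h e) \<and>
         iso_verts h (snd e) = iso_head h (iso_arcs h e)"
      using h unfolding pre_digraph.digraph_isomorphism_def tl by auto
    have Qv: "pverts Q = iso_verts h ` verts K" and Qa: "parcs Q = iso_arcs h ` arcs K"
      and Qt: "iso_tail h = fst" "iso_head h = snd"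
      using arg_cong[OF eq, of verts] arg_cong[OF eq, of arcs] arg_cong[OF eq, of tail]
        arg_cong[OF eq, of head] by auto
    \<comment> \<open>Arcs of \<open>Q\<close> are pairs with the projections as ends, so the vertex
      map determines the arc map.\<close>
    have arc: "iso_arcs h (x, y) = (iso_verts h x, iso_verts h y)" if "(x, y) \<in> arcs K" for x y
      using ends[OF that] by (auto simp: Qt prod_eq_iff)
    define f where "f = the_inv_into (verts K) (iso_verts h)"
    have f: "f i \<in> verts K" "iso_verts h (f i) = i" if "i \<in> pverts Q" for i
      using that inj unfolding Qv f_def by (auto intro: the_inv_into_into f_the_inv_into_f)
    have "(f i, f j) \<in> parcs G \<longleftrightarrow> (i, j) \<in> parcs Q" if ij: "i \<in> pverts Q" "j \<in> pverts Q" for i j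
    proof
      assume "(f i, f j) \<in> parcs G"
      then have "(f i, f j) \<in> arcs K" using f[OF ij(1)] f[OF ij(2)] by (simp add: AK)
      then have "iso_arcs h (f i, f j) \<in> parcs Q" unfolding Qa by (rule imageI)
      moreover have "iso_arcs h (f i, f j) = (i, j)"
        using arc[OF \<open>(f i, f j) \<in> arcs K\<close>] f(2)[OF ij(1)] f(2)[OF ij(2)] by simp
      ultimately show "(i, j) \<in> parcs Q" by simp
    next
      assume "(i, j) \<in> parcs Q"
      then obtain x y where xy: "(x, y) \<in> arcs K" "iso_arcs h (x, y) = (i, j)"
        by (auto simp: Qa)
      then have "iso_verts h x = i" "iso_verts h y = j" using arc by auto
      moreover have "x \<in> verts K" "y \<in> verts K" using xy by (auto simp: AK)
      ultimately have "f i = x" "f j = y" using inj by (auto simp: f_def the_inv_into_f_f)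
      then show "(f i, f j) \<in> parcs G" using xy by (simp add: AK)
    qed
    moreover have "inj_on f (pverts Q)" using f(2) by (rule inj_on_inverseI)
    ultimately show ?R using f(1) VK by (intro exI[of _ f]) blast
  next
    assume ?R
    then obtain f where inj: "inj_on f (pverts Q)" and sub: "f ` pverts Q \<subseteq> pverts G"
      and f: "\<And>i j. i \<in> pverts Q \<Longrightarrow> j \<in> pverts Q \<Longrightarrow> (f i, f j) \<in> parcs G \<longleftrightarrow> (i, j) \<in> parcs Q"
      by blast
    define K where "K = with_proj G \<restriction> (f ` pverts Q)"
    define g where "g = the_inv_into (pverts Q) f"
    have g: "g (f i) = i" if "i \<in> pverts Q" for i
      using that inj by (simp add: g_def the_inv_into_f_f)
    define h where "h = \<lparr>iso_verts = g, iso_arcs = map_prod g g, iso_head = snd, iso_tail = fst\<rparr>"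
    have ind: "induced_subgraph K (with_proj G)"
      unfolding K_def using sub by (intro induced_induce) auto
    have arcs: "arcs K = map_prod f f ` parcs Q"
    proof
      show "arcs K \<subseteq> map_prod f f ` parcs Q"
        using f by (fastforce simp: K_def)
      show "map_prod f f ` parcs Q \<subseteq> arcs K"
        using f Q by (fastforce simp: K_def)
    qed
    have inj_g: "inj_on g (f ` pverts Q)" using g by (auto intro!: inj_onI)
    have "inj_on (map_prod g g) (arcs K)"
      by (rule inj_on_subset[OF map_prod_inj_on[OF inj_g inj_g]]) (use Q in \<open>auto simp: arcs\<close>)
    moreover have "wf_digraph K" using ind by (auto simp: induced_subgraph_def subgraph_def)
    ultimately have "pre_digraph.digraph_isomorphism K h"
      using inj_g unfolding pre_digraph.digraph_isomorphism_def by (auto simp: h_def K_def)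
    moreover have "with_proj Q = app_iso h K"
    proof -
      have "iso_verts h ` verts K = pverts Q" using g by (auto simp: h_def K_def image_image)
      moreover have "map_prod g g (map_prod f f e) = e" if "e \<in> parcs Q" for e
        using that g Q by (cases e) auto
      then have "iso_arcs h ` arcs K = parcs Q" by (auto simp: h_def arcs image_image)
      ultimately show ?thesis by (simp add: app_iso_def with_proj_def h_def)
    qed
    ultimately show ?L using ind unfolding digraph_iso_def by blast
  qed
  then show ?thesis by (simp add: induced_free_def)
qed

lemma pair_graph_ugraph:
  assumes "pair_graph G" shows "ugraph (parcs G)"
proof -
  interpret pair_graph G by fact
  show ?thesis
  proof
    show "(v, u) \<in> parcs G" if "(u, v) \<in> parcs G" for u v
      using that pair_sym_arcs by (auto simp: symmetric_def sym_def)
    show "(u, u) \<notin> parcs G" for u using pair_no_loops by fastforce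
  qed
qed

lemma pair_graph_parcs_subset:
  assumes "pair_graph G" shows "parcs G \<subseteq> pverts G \<times> pverts G"
proof -
  interpret pair_graph G by fact
  show ?thesis using wellformed' by auto
qed

lemma ugraph_pair_graph:
  assumes "ugraph E" "finite V" "E \<subseteq> V \<times> V"
  shows "pair_graph \<lparr>pverts = V, parcs = E\<rparr>"
proof -
  interpret ugraph E by fact
  have "finite E" using assms(2,3) by (auto intro: finite_subset)
  then show ?thesis
    using assms(2,3) sym by unfold_locales (auto simp: symmetric_def sym_def)
qed

lemma chordal_iff:
  assumes "pair_graph H"
  shows "chordal H \<longleftrightarrow> (\<forall>f t. \<not> ugraph.hole (parcs H) (pverts H) f t)"
proof -
  interpret pair_graph H by fact
  interpret H: ugraph "parcs H" using assms by (rule pair_graph_ugraph)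
  have "\<not> induced_free (cycle_graph t) H \<longleftrightarrow> (\<exists>f. H.hole (pverts H) f t)" if t: "4 \<le> t" for t
  proof -
    \<comment> \<open>For \<open>i < j\<close> the successor modulo \<open>t\<close> wraps around
      only from \<open>t - 1\<close> to 0.\<close>
    have cyc: "j = Suc i mod t \<or> i = Suc j mod t \<longleftrightarrow> j = Suc i \<or> i = 0 \<and> Suc j = t"
      if "i < j" "j < t" for i j
      using that t by (cases "Suc j = t") auto
    have "H.hole (pverts H) f t \<longleftrightarrow> inj_on f {..<t} \<and> f ` {..<t} \<subseteq> pverts H \<and>
      (\<forall>i\<in>{..<t}. \<forall>j\<in>{..<t}. (f i, f j) \<in> parcs H \<longleftrightarrow> j = Suc i mod t \<or> i = Suc j mod t)" for f
    proof
      assume h: "H.hole (pverts H) f t"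
      then have ne: "\<And>i j. i < j \<Longrightarrow> j < t \<Longrightarrow> f i \<noteq> f j"
        and adj: "\<And>i j. i < j \<Longrightarrow> j < t \<Longrightarrow> (f i, f j) \<in> parcs H \<longleftrightarrow> j = Suc i mod t \<or> i = Suc j mod t"
        using cyc by (auto simp: H.hole_def)
      have "inj_on f {..<t}"
        by (rule linorder_inj_onI') (use ne in auto)
      moreover have "(f i, f j) \<in> parcs H \<longleftrightarrow> j = Suc i mod t \<or> i = Suc j mod t"
        if "i < t" "j < t" for i j
      proof (cases i j rule: linorder_cases)
        case less then show ?thesis using adj that by blast
      next
        case equal
        moreover have "i \<noteq> Suc i mod t" using that(1) t by (cases "Suc i = t") auto
        ultimately show ?thesis by auto
      next
        case greater then show ?thesis using adj[of j i] that H.sym by blast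
      qed
      ultimately show "inj_on f {..<t} \<and> f ` {..<t} \<subseteq> pverts H \<and>
        (\<forall>i\<in>{..<t}. \<forall>j\<in>{..<t}. (f i, f j) \<in> parcs H \<longleftrightarrow> j = Suc i mod t \<or> i = Suc j mod t)"
        using h by (auto simp: H.hole_def)
    next
      assume *: "inj_on f {..<t} \<and> f ` {..<t} \<subseteq> pverts H \<and>
        (\<forall>i\<in>{..<t}. \<forall>j\<in>{..<t}. (f i, f j) \<in> parcs H \<longleftrightarrow> j = Suc i mod t \<or> i = Suc j mod t)"
      then have "f i \<noteq> f j" if "i < j" "j < t" for i j
        using that by (auto dest!: inj_onD[of f "{..<t}" i j])
      moreover have "(f i, f j) \<in> parcs H \<longleftrightarrow> j = Suc i \<or> i = 0 \<and> Suc j = t" if "i < j" "j < t" for i j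
        using * that cyc[OF that] by auto
      ultimately show "H.hole (pverts H) f t" using * t by (auto simp: H.hole_def)
    qed
    then show ?thesis
      by (subst induced_free_iff) (auto simp: cycle_graph_def intro: pair_wf_digraph_axioms)
  qed
  moreover have "4 \<le> t" if "H.hole (pverts H) f t" for f t using that by (simp add: H.hole_def)
  ultimately show ?thesis unfolding chordal_def by blast
qed

lemma P6_free_if:
  assumes "pair_graph G" "induced_free (path_graph 6) G"
  shows "ugraph.P6_free (parcs G) (pverts G)"
proof -
  interpret pair_graph G by fact
  interpret G: ugraph "parcs G" using assms by (intro pair_graph_ugraph)
  show ?thesis
    unfolding G.P6_free_def
  proof (rule notI, elim bexE conjE)
    fix a b c d e f
    assume V: "a \<in> pverts G" "b \<in> pverts G" "c \<in> pverts G" "d \<in> pverts G" "e \<in> pverts G" "f \<in> pverts G"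
      and E: "(a, b) \<in> parcs G" "(b, c) \<in> parcs G" "(c, d) \<in> parcs G" "(d, e) \<in> parcs G" "(e, f) \<in> parcs G"
      and N: "(a, c) \<notin> parcs G" "(a, d) \<notin> parcs G" "(a, e) \<notin> parcs G" "(a, f) \<notin> parcs G"
        "(b, d) \<notin> parcs G" "(b, e) \<notin> parcs G" "(b, f) \<notin> parcs G"
        "(c, e) \<notin> parcs G" "(c, f) \<notin> parcs G" "(d, f) \<notin> parcs G"
    define g where "g = nth [a, b, c, d, e, f]"
    have six: "{..<6::nat} = {0, 1, 2, 3, 4, 5}" by auto
    note E' = E[THEN G.sym]
    have N': "(c, a) \<notin> parcs G" "(d, a) \<notin> parcs G" "(e, a) \<notin> parcs G" "(f, a) \<notin> parcs G"
        "(d, b) \<notin> parcs G" "(e, b) \<notin> parcs G" "(f, b) \<notin> parcs G"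
        "(e, c) \<notin> parcs G" "(f, c) \<notin> parcs G" "(f, d) \<notin> parcs G"
      using N G.sym by blast+
    have g: "g 0 = a" "g (Suc 0) = b" "g 2 = c" "g 3 = d" "g 4 = e" "g 5 = f"
      by (simp_all add: g_def)
    have "distinct [a, b, c, d, e, f]"
      using E E' N N' by auto
    then have "inj_on g {..<6}" unfolding six inj_on_def by (auto simp: g)
    moreover have "g ` {..<6} \<subseteq> pverts G" unfolding six using V by (auto simp: g)
    moreover have "\<forall>i\<in>{..<6}. \<forall>j\<in>{..<6}. (g i, g j) \<in> parcs G \<longleftrightarrow> j = Suc i \<or> i = Suc j"
      unfolding six using E E' N N' by (auto simp: g)
    moreover have V6: "pverts (path_graph 6) = {..<6}"
      and "\<And>i j. i < 6 \<Longrightarrow> j < 6 \<Longrightarrow> (i, j) \<in> parcs (path_graph 6) \<longleftrightarrow> j = Suc i \<or> i = Suc j"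
      by (auto simp: path_graph_def)
    ultimately have "\<exists>g. inj_on g (pverts (path_graph 6)) \<and> g ` pverts (path_graph 6) \<subseteq> pverts G \<and>
      (\<forall>i\<in>pverts (path_graph 6). \<forall>j\<in>pverts (path_graph 6).
        (g i, g j) \<in> parcs G \<longleftrightarrow> (i, j) \<in> parcs (path_graph 6))"
      by (intro exI[of _ g]) (simp add: V6)
    moreover have "parcs (path_graph 6) \<subseteq> pverts (path_graph 6) \<times> pverts (path_graph 6)"
      by (auto simp: path_graph_def)
    ultimately show False
      using induced_free_iff[OF pair_wf_digraph_axioms, of "path_graph 6"] assms(2) by blast
  qed
qed

text \<open>\<open>rtrancl_on\<close> already confines walks to the remaining vertices, so
  restricting the arcs changes nothing; by symmetry, strong components are reachability
  classes.\<close>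

lemma components_minus_eq:
  assumes "pair_graph G"
  shows "components_minus G X = ugraph.comps (parcs G) (pverts G - X)"
proof -
  interpret G: ugraph "parcs G" using assms by (rule pair_graph_ugraph)
  let ?Y = "pverts G - X" and ?H = "with_proj G \<restriction> (pverts G - X)"
  have ends: "arcs_ends ?H = parcs G \<inter> ?Y \<times> ?Y"
    by (auto simp: arcs_ends_def arc_to_ends_def)
  have "(u, v) \<in> rtrancl_on ?Y (parcs G \<inter> ?Y \<times> ?Y) \<longleftrightarrow> (u, v) \<in> rtrancl_on ?Y (parcs G)" for u v
  proof
    show "(u, v) \<in> rtrancl_on ?Y (parcs G)" if "(u, v) \<in> rtrancl_on ?Y (parcs G \<inter> ?Y \<times> ?Y)"
      using that by (induct rule: rtrancl_on_induct) (auto intro: rtrancl_on_into_rtrancl_on)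
    show "(u, v) \<in> rtrancl_on ?Y (parcs G \<inter> ?Y \<times> ?Y)" if "(u, v) \<in> rtrancl_on ?Y (parcs G)"
      using that by (induct rule: rtrancl_on_induct) (auto intro: rtrancl_on_into_rtrancl_on)
  qed
  then have reach: "u \<rightarrow>\<^sup>*\<^bsub>?H\<^esub> v \<longleftrightarrow> v \<in> G.comp ?Y u" for u v
    by (simp add: reachable_def ends G.comp_def)
  have comp_sym: "u \<in> G.comp ?Y v" if "v \<in> G.comp ?Y u" for u v
    using that G.rtrancl_on_sym by (simp add: G.comp_def)
  have "C \<in> components_minus G X \<longleftrightarrow> C \<in> G.comps ?Y" for C
  proof
    assume "C \<in> components_minus G X"
    then have C: "C \<noteq> {}" "\<And>u v. u \<in> C \<Longrightarrow> v \<in> C \<Longrightarrow> v \<in> G.comp ?Y u"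
      "\<And>u v. u \<in> C \<Longrightarrow> v \<notin> C \<Longrightarrow> v \<in> G.comp ?Y u \<Longrightarrow> u \<notin> G.comp ?Y v"
      unfolding components_minus_def pre_digraph.sccs_verts_def reach by auto
    then obtain u where u: "u \<in> C" by blast
    have "C = G.comp ?Y u" using C(2,3) u comp_sym by blast
    moreover have "u \<in> ?Y" using C(2)[OF u u] G.comp_subset by blast
    ultimately show "C \<in> G.comps ?Y" by (simp add: G.comp_in_comps)
  next
    assume C: "C \<in> G.comps ?Y"
    then have "C \<noteq> {}" "\<And>u. u \<in> C \<Longrightarrow> G.comp ?Y u = C"
      using G.comp_eq_comps by (auto simp: G.comps_iff G.conn_def)
    then show "C \<in> components_minus G X"
      unfolding components_minus_def pre_digraph.sccs_verts_def reach by auto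
  qed
  then show ?thesis by blast
qed

lemma minimal_separator_iff:
  assumes "pair_graph G"
  shows "minimal_separator G X \<longleftrightarrow> ugraph.minsep (parcs G) (pverts G) X"
proof -
  interpret G: ugraph "parcs G" using assms by (rule pair_graph_ugraph)
  have "nbhd G C = G.nb (pverts G) C" for C by (simp add: nbhd_def G.nb_def)
  then show ?thesis
    unfolding minimal_separator_def full_component_def components_minus_eq[OF assms] G.minsep_def
    by blast
qed

lemma is_clique_iff:
  assumes "pair_graph G"
  shows "is_clique G K \<longleftrightarrow> K \<subseteq> pverts G \<and> ugraph.clique (parcs G) K"
proof -
  interpret G: ugraph "parcs G" using assms by (rule pair_graph_ugraph)
  show ?thesis by (simp add: is_clique_def G.clique_def)
qed

lemma pmc_if_potential_maximal_clique:
  assumes G: "pair_graph G" and \<Omega>: "potential_maximal_clique G \<Omega>"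
  shows "ugraph.pmc (parcs G) (pverts G) \<Omega>"
proof -
  obtain H where H: "minimal_triangulation G H" "maximal_clique H \<Omega>"
    using \<Omega> unfolding potential_maximal_clique_def by blast
  have tri: "pair_graph H" "chordal H" and span: "spanning (with_proj G) (with_proj H)"
    using H(1) by (auto simp: minimal_triangulation_def triangulation_def)
  have V: "pverts H = pverts G" and E: "parcs G \<subseteq> parcs H"
    using span by (auto simp: spanning_def subgraph_def)
  have fin: "finite (pverts G)"
    using G by (simp add: pair_graph_def pair_digraph_def pair_fin_digraph_def pair_fin_digraph_axioms_def)
  have subH: "parcs H \<subseteq> pverts G \<times> pverts G" using pair_graph_parcs_subset[OF tri(1)] V by simp
  interpret H: ugraph "parcs H" using tri(1) by (rule pair_graph_ugraph)
  show ?thesis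
  proof (rule pmc_of_minimal_triangulation[OF pair_graph_ugraph[OF G] H.ugraph_axioms fin E subH])
    show "\<not> H.hole (pverts G) f t" for f t using tri(2) chordal_iff[OF tri(1)] V by simp
    \<comment> \<open>Such a relation \<open>F\<close> is the arc set of a triangulation of
      \<open>G\<close> on the same vertices, so minimality of \<open>H\<close> among graphs
      applies.\<close>
    show "F = parcs H" if F: "ugraph F" "parcs G \<subseteq> F" "F \<subseteq> parcs H" "\<And>f t. \<not> ugraph.hole F (pverts G) f t"
      for F
    proof -
      let ?F = "\<lparr>pverts = pverts G, parcs = F\<rparr>"
      have pg: "pair_graph ?F" using F subH fin by (intro ugraph_pair_graph) auto
      then interpret F: pair_graph ?F .
      interpret G: pair_graph G by fact
      have "spanning (with_proj G) (with_proj ?F)"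
        using F(2) by (auto simp: spanning_def subgraph_def
            intro: F.wf_digraph_axioms G.wf_digraph_axioms)
      moreover have "chordal ?F" using chordal_iff[OF pg] F(4) by simp
      ultimately have "triangulation G ?F" using pg by (simp add: triangulation_def)
      then have "?F = H" using H(1) F(3) by (simp add: minimal_triangulation_def)
      then show ?thesis by auto
    qed
    show "\<Omega> \<subseteq> pverts G" "H.clique \<Omega>"
      using H(2) V is_clique_iff[OF tri(1)] by (auto simp: maximal_clique_def)
    show False if "x \<in> pverts G" "x \<notin> \<Omega>" "H.clique (insert x \<Omega>)" for x
      using that H(2) V is_clique_iff[OF tri(1)] unfolding maximal_clique_def
      by (metis insertI1 insert_subset subset_insertI)
  qed
qed

theorem theorem3:
  fixes G :: "'a pair_pre_digraph" and n k :: nat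
  assumes "pair_graph G"
    and "pverts G \<noteq> {}"
    and "card (pverts G) = n"
    and "induced_free (path_graph 6) G"
    and "clique_number G = k"
  shows "card {X. minimal_separator G X} \<le> (2 * n) ^ (k + 1)
    \<and> card {\<Omega>. potential_maximal_clique G \<Omega>} \<le> 2 ^ (2 * k + 2) * n ^ (2 * k + 3)"
proof -
  interpret pair_graph G by fact
  interpret G: ugraph "parcs G" using assms(1) by (rule pair_graph_ugraph)
  let ?V = "pverts G"
  have fin: "finite ?V" by (rule pair_finite_verts)
  have n: "1 \<le> n" using fin assms(2) card_gt_0_iff[of ?V] unfolding assms(3) by simp
  have P6: "G.P6_free ?V" using assms(1,4) by (rule P6_free_if)
  have "finite {K. is_clique G K}"
    by (rule finite_subset[of _ "Pow ?V"]) (use fin in \<open>auto simp: is_clique_def\<close>)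
  then have cl: "card K \<le> k" if "K \<subseteq> ?V" "G.clique K" for K
    using that assms(5) is_clique_iff[OF assms(1)] unfolding clique_number_def
    by (metis Max_ge finite_imageI imageI mem_Collect_eq)
  define d where "d = n * (2 * n) ^ k"
  \<comment> \<open>Being \<open>P\<^sub>6\<close>-free and having cliques of size at most
    \<open>k\<close> pass to induced subgraphs, so one \<open>d\<close> serves the whole
    induction.\<close>
  have d: "card {S. G.minsep W S} \<le> d" if W: "W \<subseteq> ?V" for W
  proof -
    have "finite W" using W fin by (rule finite_subset)
    moreover have "G.P6_free W" using P6 W unfolding G.P6_free_def by (meson subsetD)
    ultimately have "card {S. G.minsep W S} \<le> card W * (2 * card W) ^ k"
      using W cl by (intro G.card_minsep) auto
    also have "card W \<le> n" using W fin assms(3) card_mono by blast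
    finally show ?thesis unfolding d_def
      using \<open>card W \<le> n\<close> by (meson mult_le_mono order_refl order_trans power_mono zero_le)
  qed
  have dn: "(2 * n) ^ (k + 1) = 2 * d" by (simp add: d_def)
  have "card {X. minimal_separator G X} \<le> (2 * n) ^ (k + 1)"
    using d[OF order_refl] unfolding minimal_separator_iff[OF assms(1)] dn by linarith
  moreover have "card {\<Omega>. potential_maximal_clique G \<Omega>} \<le> 2 ^ (2 * k + 2) * n ^ (2 * k + 3)"
  proof -
    have "card {\<Omega>. potential_maximal_clique G \<Omega>} \<le> card {\<Omega>. G.pmc ?V \<Omega>}"
    proof (rule card_mono)
      show "finite {\<Omega>. G.pmc ?V \<Omega>}"
        by (rule finite_subset[of _ "Pow ?V"]) (use fin in \<open>auto simp: G.pmc_def\<close>)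
    qed (use pmc_if_potential_maximal_clique[OF assms(1)] in auto)
    also have "\<dots> \<le> n * (d + d * d) + 1" using G.card_pmc[OF fin d] assms(3) by simp
    \<comment> \<open>As \<open>n\<close> and \<open>d\<close> are positive, both
      \<open>n * d\<close> and 1 are at most \<open>n * (d * d)\<close>. The factor 4 turns
      \<open>d * d\<close> into the square of \<open>2 * d\<close>, that is, of
      \<open>(2 * n) ^ (k + 1)\<close>.\<close>
    also have "\<dots> \<le> n * (4 * (d * d))"
    proof -
      have "1 \<le> d" using n by (simp add: d_def Suc_le_eq)
      then have "d \<le> d * d" by simp
      moreover have "1 \<le> n * (d * d)" using n \<open>1 \<le> d\<close> by (simp add: Suc_le_eq)
      ultimately have "n * (d + d * d) + 1 \<le> n * (d * d + d * d) + n * (d * d)"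
        by (intro add_mono mult_le_mono) auto
      then show ?thesis by (simp add: algebra_simps)
    qed
    also have "n * (4 * (d * d)) = n * ((2 * n) ^ (k + 1) * (2 * n) ^ (k + 1))" unfolding dn by simp
    also have "\<dots> = n * (2 * n) ^ (2 * k + 2)" by (simp add: power_add[symmetric] mult_2)
    also have "\<dots> = 2 ^ (2 * k + 2) * n ^ (2 * k + 3)"
    proof -
      have "n ^ (2 * k + 3) = n * n ^ (2 * k + 2)" by (simp add: eval_nat_numeral)
      then show ?thesis by (simp only: power_mult_distrib mult.left_commute)
    qed
    finally show ?thesis .
  qed
  ultimately show ?thesis ..
qed

end
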